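(* Let $p>3$ be prime and $1\le\ell\le p-1$. Then the function $\eta(p^2z)\,q^{-1/24}\,C(\zeta_p^{\ell},q)$ is a weakly holomorphic modular form of weight $1$ on the group $\Gamma_0(p^2)\cap\Gamma_1(p)$.
   Context: $z$ lies in the upper half-plane, $q=e^{2\pi i z}$, $q^r=e^{2\pi i r z}$, $\zeta_p=e^{2\pi i/p}$, $\eta(z)=q^{1/24}\prod_{n\ge1}(1-q^n)$, and $(a;q)_\infty=\prod_{k\ge0}(1-aq^k)$. The crank generating function is $C(x,q)=\dfrac{(q;q)_\infty}{(xq;q)_\infty(x^{-1}q;q)_\infty}$ (Andrews–Garvan). *)

theory Defs
  imports "HOL-Complex_Analysis.Complex_Analysis"
begin

definition upper_half_plane :: "complex set" where
  "upper_half_plane = {z. Im z > 0}"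

definition qexp :: "real \<Rightarrow> complex \<Rightarrow> complex" where
  "qexp r z = exp (2 * pi * \<i> * of_real r * z)"

definition qpoch_inf :: "complex \<Rightarrow> complex \<Rightarrow> complex" where
  "qpoch_inf a q = (\<Prod>k. 1 - a * q ^ k)"

definition dedekind_eta :: "complex \<Rightarrow> complex" where
  "dedekind_eta z = qexp (1/24) z * (\<Prod>n. 1 - (qexp 1 z) ^ Suc n)"

definition crank_gf :: "complex \<Rightarrow> complex \<Rightarrow> complex" where
  "crank_gf x q = qpoch_inf q q / (qpoch_inf (x * q) q * qpoch_inf (inverse x * q) q)"

text \<open>Integer 2x2 matrices (a,b,c,d) = [[a,b],[c,d]]\<close>
type_synonym mat2 = "int \<times> int \<times> int \<times> int"

definition SL2Z :: "mat2 set" where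
  "SL2Z = {(a,b,c,d). a * d - b * c = 1}"

definition Gamma0_Gamma1 :: "int \<Rightarrow> int \<Rightarrow> mat2 set" where
  "Gamma0_Gamma1 M N = {(a,b,c,d). (a,b,c,d) \<in> SL2Z \<and> M dvd c \<and> N dvd c
       \<and> a mod N = 1 mod N \<and> d mod N = 1 mod N}"

definition moebius :: "mat2 \<Rightarrow> complex \<Rightarrow> complex" where
  "moebius g z = (case g of (a,b,c,d) \<Rightarrow> (of_int a * z + of_int b) / (of_int c * z + of_int d))"

definition slash :: "int \<Rightarrow> (complex \<Rightarrow> complex) \<Rightarrow> mat2 \<Rightarrow> complex \<Rightarrow> complex" where
  "slash k f g z = (case g of (a,b,c,d) \<Rightarrow> (of_int c * z + of_int d) powi (-k) * f (moebius g z))"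

text \<open>Weakly holomorphic modular form of weight k on a subgroup G of SL2(Z):
  holomorphic on H, invariant under the weight-k slash action of G, and at every cusp
  (i.e. for every g in SL2(Z)) f|_k g is periodic with some period N and its expansion
  in q_N = e^{2 pi i z/N} has at worst a pole at q_N = 0 (meromorphic at the cusps).\<close>
definition weakly_holomorphic_modular_form ::
    "int \<Rightarrow> mat2 set \<Rightarrow> (complex \<Rightarrow> complex) \<Rightarrow> bool" where
  "weakly_holomorphic_modular_form k G f \<longleftrightarrow>
     f holomorphic_on upper_half_plane \<and>
     (\<forall>g\<in>G. \<forall>z\<in>upper_half_plane. slash k f g z = f z) \<and>
     (\<forall>g\<in>SL2Z. \<exists>N::nat. N > 0 \<and>
         (\<forall>z\<in>upper_half_plane. slash k f g (z + of_nat N) = slash k f g z) \<and>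
         not_essential (\<lambda>w. slash k f g (of_nat N * Ln w / (2 * pi * \<i>))) 0)"

end

theory Submission
  imports Defs "HOL-Computational_Algebra.Fundamental_Theorem_Algebra"
begin

text \<open>
  Write \<open>K(\<alpha>, \<beta>; z)\<close> for the Klein form. Its weight \<open>-1\<close> transformation law under all of
  \<open>SL\<^sub>2(\<int>)\<close> follows from Liouville's theorem: for a normalised theta function \<open>\<theta>(u, z)\<close> the quotient
  of the transformed and the original function is entire and elliptic in \<open>u\<close>.
  With \<open>r = (p - 1)/2\<close>, grouping the factors of the eta products by residue classes modulo \<open>p\<close> shows that,
  up to a constant, the function in question is
  \<open>\<Prod>\<^sub>s K(0, s/p; p z) / K(s/p, 0; p z)\<close>, \<open>1 \<le> s \<le> r\<close>, divided by \<open>K(0, l/p; z)\<close>. All powers of the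
  eta function cancel, so its multiplier system is never needed. The roots of unity that appear
  multiply to \<open>1\<close> since \<open>\<Sum>\<^sub>s s\<^sup>2 = p m\<close> and \<open>\<Sum>\<^sub>s s = 3 m\<close> with \<open>m = (p\<^sup>2 - 1)/24\<close>.
  At the cusps no expansion is required: the product formula gives \<open>|f(z)| \<le> exp (C (1 + 1/Im z))\<close>,
  and this growth bound excludes essential singularities.
\<close>

section \<open>The q-Pochhammer symbol\<close>

lemma convergent_prod_qpoch:
  fixes a q :: complex
  assumes "norm q < 1"
  shows "convergent_prod (\<lambda>k. 1 - a * q ^ k)"
proof -
  have "summable (\<lambda>k. norm ((1 - a * q ^ k) - 1))"
    using summable_mult[OF summable_geometric[of "norm q"], of "norm a"] assms
    by (simp add: norm_mult norm_power)
  thus ?thesis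
    by (intro abs_convergent_prod_imp_convergent_prod summable_imp_abs_convergent_prod)
qed

lemma qpoch_has_prod:
  assumes "norm q < 1"
  shows "(\<lambda>k. 1 - a * q ^ k) has_prod qpoch_inf a q"
  unfolding qpoch_inf_def by (intro convergent_prod_has_prod convergent_prod_qpoch assms)

lemma qpoch_tendsto:
  assumes "norm q < 1"
  shows "(\<lambda>n. \<Prod>k<n. 1 - a * q ^ k) \<longlonglongrightarrow> qpoch_inf a q"
  using has_prod_imp_tendsto'[OF qpoch_has_prod[OF assms]] .

lemma qpoch_eq_0_iff:
  assumes "norm q < 1"
  shows "qpoch_inf a q = 0 \<longleftrightarrow> (\<exists>k. a * q ^ k = 1)"
  using has_prod_eq_0_iff[OF qpoch_has_prod[OF assms]] by force

lemma qpoch_shift: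
  assumes "norm q < 1"
  shows "qpoch_inf a q = (1 - a) * qpoch_inf (a * q) q"
proof -
  have "(\<lambda>n. \<Prod>k<Suc n. 1 - a * q ^ k) \<longlonglongrightarrow> qpoch_inf a q"
    using LIMSEQ_Suc[OF qpoch_tendsto[OF assms]] .
  moreover have "(\<Prod>k<Suc n. 1 - a * q ^ k) = (1 - a) * (\<Prod>k<n. 1 - (a * q) * q ^ k)" for n
    by (subst prod.lessThan_Suc_shift) (simp add: mult_ac)
  ultimately have "(\<lambda>n. (1 - a) * (\<Prod>k<n. 1 - (a * q) * q ^ k)) \<longlonglongrightarrow> qpoch_inf a q"
    by simp
  moreover have "(\<lambda>n. (1 - a) * (\<Prod>k<n. 1 - (a * q) * q ^ k))
      \<longlonglongrightarrow> (1 - a) * qpoch_inf (a * q) q"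
    by (intro tendsto_intros qpoch_tendsto assms)
  ultimately show ?thesis
    using LIMSEQ_unique by blast
qed

lemma qpoch_nonzero:
  assumes "norm q < 1" "norm a < 1"
  shows "qpoch_inf a q \<noteq> 0"
proof -
  have "a * q ^ k \<noteq> 1" for k
  proof -
    have "norm (a * q ^ k) \<le> norm a * 1"
      unfolding norm_mult norm_power by (intro mult_left_mono power_le_one) (use assms in auto)
    thus ?thesis using assms by auto
  qed
  thus ?thesis using qpoch_eq_0_iff[OF assms(1)] by blast
qed

text \<open>Each exponent is written as s + k p with s < p, so the finite products regroup exactly.
  The limit is then taken along the subsequence of partial products of length n p.\<close>

lemma qpoch_progression:
  assumes "norm q < 1" "p > 0"
  shows "(\<Prod>s<p. qpoch_inf (a * q ^ s) (q ^ p)) = qpoch_inf a q"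
proof -
  have qp: "norm (q ^ p) < 1"
    using assms by (simp add: norm_power power_less_one_iff)
  have "(\<lambda>n. \<Prod>s<p. \<Prod>k<n. 1 - (a * q ^ s) * (q ^ p) ^ k)
      \<longlonglongrightarrow> (\<Prod>s<p. qpoch_inf (a * q ^ s) (q ^ p))"
    by (intro tendsto_prod qpoch_tendsto qp)
  moreover have "(\<Prod>s<p. \<Prod>k<n. 1 - (a * q ^ s) * (q ^ p) ^ k) = (\<Prod>m<n * p. 1 - a * q ^ m)" for n
  proof -
    have "(\<Prod>m<n * p. 1 - a * q ^ m) = (\<Prod>k<n. \<Prod>m=k*p..<k*p+p. 1 - a * q ^ m)"
      by (rule prod.nat_group[symmetric])
    also have "\<dots> = (\<Prod>k<n. \<Prod>s<p. 1 - a * q ^ (s + k * p))"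
      by (rule prod.cong[OF refl], subst atLeast0LessThan[symmetric],
          subst prod.shift_bounds_nat_ivl[symmetric]) (simp add: add.commute)
    also have "\<dots> = (\<Prod>s<p. \<Prod>k<n. 1 - a * q ^ (s + k * p))"
      by (rule prod.swap)
    finally show ?thesis
      by (simp add: power_add power_mult[symmetric] mult_ac)
  qed
  ultimately have "(\<lambda>n. \<Prod>m<n * p. 1 - a * q ^ m)
      \<longlonglongrightarrow> (\<Prod>s<p. qpoch_inf (a * q ^ s) (q ^ p))"
    by simp
  moreover have "(\<lambda>n. \<Prod>m<n * p. 1 - a * q ^ m) \<longlonglongrightarrow> qpoch_inf a q"
    using LIMSEQ_subseq_LIMSEQ[OF qpoch_tendsto[OF assms(1)], of "\<lambda>n. n * p"] assms(2)
    by (auto simp: strict_mono_def o_def)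
  ultimately show ?thesis
    using LIMSEQ_unique by blast
qed

text \<open>The derivative n X^(n-1) of X^n - 1 vanishes at no root, so X^n - 1 splits into distinct
  linear factors over the roots of unity. Evaluation at 1/y and multiplication by y^n give the
  claim.\<close>

lemma prod_one_minus_roots_of_unity:
  fixes y :: complex
  assumes "n > 0"
  shows "(\<Prod>s<n. 1 - exp (2 * pi * \<i> / of_nat n) ^ s * y) = 1 - y ^ n"
proof (cases "y = 0")
  case False
  define z where "z = exp (2 * pi * \<i> / of_nat n)"
  have bij: "bij_betw (\<lambda>s. z ^ s) {..<n} {w. w ^ n = 1}"
    using Complex.bij_betw_roots_unity[OF assms]
    by (simp add: z_def cis_conv_exp exp_of_nat_mult[symmetric] mult_ac)
  have "(\<Prod>s<n. inverse y - z ^ s) = (\<Prod>w | w ^ n = 1. inverse y - w)"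
    by (rule prod.reindex_bij_betw[OF bij])
  also have "\<dots> = inverse y ^ n - 1"
  proof -
    define P :: "complex poly" where "P = monom 1 n - 1"
    have P: "poly P w = w ^ n - 1" for w
      by (simp add: P_def poly_monom)
    have dP: "poly (pderiv P) w = of_nat n * w ^ (n - 1)" for w
      by (simp add: P_def pderiv_diff pderiv_monom poly_monom)
    have "rsquarefree P"
      unfolding rsquarefree_roots P dP using assms by (auto simp: power_0_left)
    moreover have "lead_coeff P = 1"
    proof -
      have "degree P = n"
        unfolding P_def diff_conv_add_uminus using assms
        by (subst degree_add_eq_left) (auto simp: degree_monom_eq)
      thus ?thesis using assms by (simp add: P_def)
    qed
    ultimately have "(\<Prod>w | poly P w = 0. [:-w, 1:]) = P"
      using complex_poly_decompose_rsquarefree[of P] by simp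
    hence "poly (\<Prod>w | poly P w = 0. [:-w, 1:]) (inverse y) = poly P (inverse y)"
      by simp
    thus ?thesis by (simp add: P poly_prod)
  qed
  finally have *: "(\<Prod>s<n. inverse y - z ^ s) = inverse y ^ n - 1" .
  have "(\<Prod>s<n. 1 - z ^ s * y) = (\<Prod>s<n. y * (inverse y - z ^ s))"
    using False by (intro prod.cong) (auto simp: field_simps)
  also have "\<dots> = y ^ n * (inverse y ^ n - 1)"
    by (simp add: prod.distrib *)
  also have "\<dots> = 1 - y ^ n"
    using False by (simp add: field_simps)
  finally show ?thesis by (simp add: z_def)
qed (use assms in auto)

text \<open>For fixed k, the p factors belonging to the different roots of unity collapse to 1 - (a
  q^k)^p by the finite identity above.\<close>

lemma qpoch_roots_of_unity:
  assumes "norm q < 1" "p > 0"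
  shows "(\<Prod>s<p. qpoch_inf (exp (2 * pi * \<i> / of_nat p) ^ s * a) q) = qpoch_inf (a ^ p) (q ^ p)"
proof -
  have qp: "norm (q ^ p) < 1"
    using assms by (simp add: norm_power power_less_one_iff)
  have "(\<lambda>n. \<Prod>s<p. \<Prod>k<n. 1 - (exp (2 * pi * \<i> / of_nat p) ^ s * a) * q ^ k)
      \<longlonglongrightarrow> (\<Prod>s<p. qpoch_inf (exp (2 * pi * \<i> / of_nat p) ^ s * a) q)"
    by (intro tendsto_prod qpoch_tendsto assms)
  moreover have "(\<Prod>s<p. \<Prod>k<n. 1 - (exp (2 * pi * \<i> / of_nat p) ^ s * a) * q ^ k)
      = (\<Prod>k<n. 1 - a ^ p * (q ^ p) ^ k)" for n
  proof -
    have "(\<Prod>s<p. \<Prod>k<n. 1 - (exp (2 * pi * \<i> / of_nat p) ^ s * a) * q ^ k)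
        = (\<Prod>k<n. \<Prod>s<p. 1 - exp (2 * pi * \<i> / of_nat p) ^ s * (a * q ^ k))"
      by (subst prod.swap) (simp add: mult_ac)
    also have "\<dots> = (\<Prod>k<n. 1 - (a * q ^ k) ^ p)"
      by (intro prod.cong refl prod_one_minus_roots_of_unity assms)
    finally show ?thesis
      by (simp add: power_mult_distrib power_mult[symmetric] mult_ac)
  qed
  ultimately have "(\<lambda>n. \<Prod>k<n. 1 - a ^ p * (q ^ p) ^ k)
      \<longlonglongrightarrow> (\<Prod>s<p. qpoch_inf (exp (2 * pi * \<i> / of_nat p) ^ s * a) q)"
    by simp
  thus ?thesis
    using LIMSEQ_unique qpoch_tendsto[OF qp] by blast
qed

text \<open>The partial products converge locally uniformly: on a small closed disc the terms are
  dominated by a geometric series M r^n with r < 1. Letting the base vary as well covers holomorphy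
  both in the elliptic variable u and in the modular variable z.\<close>

lemma holomorphic_on_qpoch:
  assumes "open S" "A holomorphic_on S" "Q holomorphic_on S" "\<And>t. t \<in> S \<Longrightarrow> norm (Q t) < 1"
  shows "(\<lambda>t. qpoch_inf (A t) (Q t)) holomorphic_on S"
proof (rule holomorphic_uniform_sequence[OF assms(1)])
  fix n :: nat
  show "(\<lambda>t. \<Prod>k<n. 1 - A t * Q t ^ k) holomorphic_on S"
    by (intro holomorphic_intros assms)
next
  fix x assume "x \<in> S"
  then obtain d where d: "d > 0" "cball x d \<subseteq> S"
    using assms(1) open_contains_cball by blast
  have cA: "continuous_on (cball x d) A" and cQ: "continuous_on (cball x d) Q"
    using assms(2,3) d(2) holomorphic_on_imp_continuous_on holomorphic_on_subset by blast+
  obtain M where M: "\<And>t. t \<in> cball x d \<Longrightarrow> norm (A t) \<le> M"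
  proof -
    have "bounded (A ` cball x d)"
      by (intro compact_imp_bounded compact_continuous_image cA) auto
    thus ?thesis using that by (force simp: bounded_iff)
  qed
  \<comment> \<open>Compactness makes the maximum of |Q| an attained value, which keeps
    \<open>r\<close> strictly below 1.\<close>
  obtain r where r: "r < 1" "\<And>t. t \<in> cball x d \<Longrightarrow> norm (Q t) \<le> r"
  proof -
    have "\<exists>u\<in>cball x d. \<forall>t\<in>cball x d. norm (Q t) \<le> norm (Q u)"
      using d(1) by (intro continuous_attains_sup continuous_on_norm cQ) auto
    thus ?thesis using that assms(4) d(2) by blast
  qed
  have r0: "r \<ge> 0"
    using r(2)[of x] d(1) by (meson centre_in_cball norm_ge_zero order.strict_implies_order order_trans)
  have M0: "M \<ge> 0"
    using M[of x] d(1) by (meson centre_in_cball norm_ge_zero order.strict_implies_order order_trans)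
  have "uniformly_convergent_on (cball x d) (\<lambda>N t. \<Prod>n<N. 1 + - (A t * Q t ^ n))"
  proof (rule uniformly_convergent_on_prod)
    show "continuous_on (cball x d) (\<lambda>t. - (A t * Q t ^ n))" for n
      by (intro continuous_intros cA cQ)
    show "uniformly_convergent_on (cball x d) (\<lambda>N t. \<Sum>n<N. norm (- (A t * Q t ^ n)))"
    proof (rule Weierstrass_m_test')
      show "norm (norm (- (A t * Q t ^ n))) \<le> M * r ^ n" if "t \<in> cball x d" for n t
        using M[OF that] r(2)[OF that] M0
        by (auto simp: norm_mult norm_power intro!: mult_mono power_mono)
      show "summable (\<lambda>n. M * r ^ n)"
        using r r0 by (intro summable_mult summable_geometric) auto
    qed
  qed auto
  then obtain L where L: "uniform_limit (cball x d) (\<lambda>N t. \<Prod>n<N. 1 - A t * Q t ^ n) L sequentially"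
    by (auto simp: uniformly_convergent_on_def)
  have "L t = qpoch_inf (A t) (Q t)" if "t \<in> cball x d" for t
    using tendsto_uniform_limitI[OF L that] qpoch_tendsto[of "Q t" "A t"] assms(4) d(2) that
    by (metis LIMSEQ_unique subsetD)
  hence "uniform_limit (cball x d) (\<lambda>N t. \<Prod>n<N. 1 - A t * Q t ^ n)
      (\<lambda>t. qpoch_inf (A t) (Q t)) sequentially"
    using L by (metis (no_types, lifting) uniform_limit_cong')
  thus "\<exists>d>0. cball x d \<subseteq> S \<and> uniform_limit (cball x d) (\<lambda>N t. \<Prod>n<N. 1 - A t * Q t ^ n)
      (\<lambda>t. qpoch_inf (A t) (Q t)) sequentially"
    using d by blast
qed

section \<open>Upper and lower bounds for the q-Pochhammer symbol\<close>

text \<open>Expanding the logarithms and summing over k first bounds -ln of the product by the sum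
  over n of t / (n (1 - t)) with t = r^n. Since n r^n is at most 1 + r + ... + r^(n-1) = (1 - t) /
  (1 - r), the n-th term is at most 1 / (n^2 (1 - r)). The constant is zeta(2), because the term n =
  0 is 0 by the convention for division by zero.\<close>

lemma prod_one_minus_power_ge:
  fixes r :: real
  assumes "0 \<le> r" "r < 1"
  shows "(\<Prod>k<N. 1 - r ^ Suc k) \<ge> exp (- ((\<Sum>n. 1 / real n ^ 2) / (1 - r)))"
proof -
  have pos: "1 - r ^ Suc k > 0" for k
    using assms by (simp add: power_less_one_iff del: power_Suc)
  have ln: "(\<lambda>n. (r ^ Suc k) ^ n / real n) sums - ln (1 - r ^ Suc k)" for k
    using sums_minus[OF ln_series'[of "- (r ^ Suc k)"]] assms pos[of k] by simp
  have "(\<lambda>n. \<Sum>k<N. (r ^ Suc k) ^ n / real n) sums (\<Sum>k<N. - ln (1 - r ^ Suc k))"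
    by (intro sums_sum ln)
  moreover have "(\<lambda>n. 1 / real n ^ 2 / (1 - r)) sums ((\<Sum>n. 1 / real n ^ 2) / (1 - r))"
    by (intro sums_divide summable_sums) (use inverse_power_summable[of 2, where 'a = real] in \<open>simp add: field_simps\<close>)
  moreover have "(\<Sum>k<N. (r ^ Suc k) ^ n / real n) \<le> 1 / real n ^ 2 / (1 - r)" for n
  proof (cases "n = 0")
    case False
    define t where "t = r ^ n"
    have t: "0 \<le> t" "t < 1"
      using assms False by (auto simp: t_def power_less_one_iff)
    have "(\<Sum>k<N. t ^ Suc k) * (1 - t) = t * (1 - t ^ N)"
      using t by (simp add: sum_distrib_left[symmetric] sum_gp_strict)
    also have "\<dots> \<le> t * 1"
      using t by (intro mult_left_mono) auto
    finally have 1: "(\<Sum>k<N. t ^ Suc k) \<le> t / (1 - t)"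
      using t by (simp add: field_simps)
    have "real n * t = (\<Sum>i<n. r ^ n)"
      by (simp add: t_def)
    also have "\<dots> \<le> (\<Sum>i<n. r ^ i)"
      using assms by (intro sum_mono power_decreasing) auto
    also have "\<dots> = (1 - t) / (1 - r)"
      using assms by (simp add: sum_gp_strict t_def)
    finally have "t / (1 - t) \<le> 1 / (real n * (1 - r))"
      using t assms False by (simp add: field_simps)
    with 1 have "(\<Sum>k<N. t ^ Suc k) / real n \<le> 1 / (real n * (1 - r)) / real n"
      by (intro divide_right_mono) auto
    moreover have "(r ^ Suc k) ^ n = t ^ Suc k" for k
      unfolding t_def power_mult[symmetric] by (simp add: mult.commute)
    ultimately show ?thesis
      by (simp add: sum_divide_distrib power2_eq_square field_simps)
  qed auto
  ultimately have "(\<Sum>k<N. - ln (1 - r ^ Suc k)) \<le> (\<Sum>n. 1 / real n ^ 2) / (1 - r)"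
    by (rule sums_le[rotated 1])
  hence "exp (- ((\<Sum>n. 1 / real n ^ 2) / (1 - r))) \<le> exp (\<Sum>k<N. ln (1 - r ^ Suc k))"
    by (simp add: sum_negf)
  also have "\<dots> = (\<Prod>k<N. 1 - r ^ Suc k)"
    using pos by (simp add: exp_sum)
  finally show ?thesis .
qed

text \<open>This lower bound controls the denominator of the crank function, uniformly in the
  argument of \<open>a\<close>.\<close>

lemma norm_qpoch_ge:
  assumes "norm q < 1" "norm a \<le> 1"
  shows "norm (qpoch_inf (a * q) q) \<ge> exp (- ((\<Sum>n. 1 / real n ^ 2) / (1 - norm q)))"
proof (rule LIMSEQ_le_const)
  show "(\<lambda>n. norm (\<Prod>k<n. 1 - a * q * q ^ k)) \<longlonglongrightarrow> norm (qpoch_inf (a * q) q)"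
    by (intro tendsto_norm qpoch_tendsto assms)
  have "exp (- ((\<Sum>n. 1 / real n ^ 2) / (1 - norm q))) \<le> norm (\<Prod>k<n. 1 - a * q * q ^ k)" for n
  proof -
    have "exp (- ((\<Sum>n. 1 / real n ^ 2) / (1 - norm q))) \<le> (\<Prod>k<n. 1 - norm q ^ Suc k)"
      by (rule prod_one_minus_power_ge) (use assms in auto)
    also have "\<dots> \<le> (\<Prod>k<n. norm (1 - a * q * q ^ k))"
    proof (intro prod_mono conjI)
      fix k
      show "0 \<le> 1 - norm q ^ Suc k"
        using assms by (simp add: power_le_one mult_le_one)
      have "norm (a * q * q ^ k) \<le> norm q ^ Suc k"
        using mult_right_mono[OF assms(2), of "norm q ^ Suc k"]
        by (simp add: norm_mult norm_power mult_ac)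
      thus "1 - norm q ^ Suc k \<le> norm (1 - a * q * q ^ k)"
        using norm_triangle_ineq2[of 1 "a * q * q ^ k"] by simp
    qed
    finally show ?thesis by (simp add: prod_norm)
  qed
  thus "\<exists>N. \<forall>n\<ge>N. exp (- ((\<Sum>n. 1 / real n ^ 2) / (1 - norm q)))
      \<le> norm (\<Prod>k<n. 1 - a * q * q ^ k)"
    by blast
qed

lemma norm_qpoch_le:
  assumes "norm q < 1" "norm a \<le> 1"
  shows "norm (qpoch_inf (a * q) q) \<le> exp (1 / (1 - norm q))"
proof (rule LIMSEQ_le_const2)
  show "(\<lambda>n. norm (\<Prod>k<n. 1 - a * q * q ^ k)) \<longlonglongrightarrow> norm (qpoch_inf (a * q) q)"
    by (intro tendsto_norm qpoch_tendsto assms)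
  have "norm (\<Prod>k<n. 1 - a * q * q ^ k) \<le> exp (1 / (1 - norm q))" for n
  proof -
    have "norm (\<Prod>k<n. 1 - a * q * q ^ k) \<le> (\<Prod>k<n. 1 + norm q ^ k)"
      unfolding prod_norm[symmetric]
    proof (intro prod_mono conjI norm_ge_zero)
      fix k
      have "norm a * (norm q * norm q ^ k) \<le> 1 * (1 * norm q ^ k)"
        using assms by (intro mult_mono) auto
      thus "norm (1 - a * q * q ^ k) \<le> 1 + norm q ^ k"
        using norm_triangle_ineq4[of 1 "a * q * q ^ k"] by (simp add: norm_mult norm_power)
    qed
    also have "\<dots> \<le> exp (\<Sum>k<n. norm q ^ k)"
      by (rule prod_le_exp_sum) auto
    also have "(\<Sum>k<n. norm q ^ k) \<le> 1 / (1 - norm q)"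
      using assms by (simp add: sum_gp_strict divide_simps)
    finally show ?thesis by simp
  qed
  thus "\<exists>N. \<forall>n\<ge>N. norm (\<Prod>k<n. 1 - a * q * q ^ k) \<le> exp (1 / (1 - norm q))"
    by blast
qed

section \<open>Entire elliptic functions\<close>

text \<open>The zeros of B are simple and A vanishes at each of them, so all singularities of A / B
  are removable.\<close>

lemma holomorphic_quotient:
  assumes A: "A holomorphic_on UNIV" and B: "B holomorphic_on UNIV"
    and zeros: "\<And>u. B u = 0 \<Longrightarrow> A u = 0 \<and> deriv B u \<noteq> 0"
  obtains G where "G holomorphic_on UNIV" "\<And>u. A u = G u * B u"
proof
  \<comment> \<open>At a zero of B the value is the limit of A / B given by l'Hopital's
    rule.\<close>
  define G where "G = (\<lambda>u. if B u = 0 then deriv A u / deriv B u else A u / B u)"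
  show "A u = G u * B u" for u
    using zeros[of u] by (auto simp: G_def)
  show "G holomorphic_on UNIV"
  proof (rule analytic_imp_holomorphic, rule analytic_on_analytic_at[THEN iffD2], intro ballI)
    fix w
    show "G analytic_on {w}"
    proof (cases "B w = 0")
      case False
      define S where "S = {u. B u \<noteq> 0}"
      have "open S"
        unfolding S_def by (intro open_Collect_neq continuous_intros holomorphic_on_imp_continuous_on B)
      moreover have "(\<lambda>u. A u / B u) holomorphic_on S"
        by (intro holomorphic_intros holomorphic_on_subset[OF A] holomorphic_on_subset[OF B])
           (auto simp: S_def)
      hence "G holomorphic_on S"
        by (rule holomorphic_transform) (auto simp: G_def S_def)
      ultimately show ?thesis
        using False by (auto simp: analytic_at S_def)
    next
      case True
      \<comment> \<open>The difference quotients at w, completed by the derivatives, are entire.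
        Since A and B vanish at w, near w the function \<open>G\<close> equals \<open>A1\<close> /
        \<open>B1\<close>, and \<open>B1\<close> w is the nonzero derivative of B.\<close>
      define A1 B1 where "A1 = (\<lambda>u. if u = w then deriv A w else (A u - A w) / (u - w))"
        and "B1 = (\<lambda>u. if u = w then deriv B w else (B u - B w) / (u - w))"
      have hA: "A1 holomorphic_on UNIV" and hB: "B1 holomorphic_on UNIV"
        unfolding A1_def B1_def by (intro pole_lemma_open A B open_UNIV)+
      define S where "S = {u. B1 u \<noteq> 0}"
      have "open S"
        unfolding S_def by (intro open_Collect_neq continuous_intros holomorphic_on_imp_continuous_on hB)
      moreover have "(\<lambda>u. A1 u / B1 u) holomorphic_on S"
        by (intro holomorphic_intros holomorphic_on_subset[OF hA] holomorphic_on_subset[OF hB])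
           (auto simp: S_def)
      hence "G holomorphic_on S"
        by (rule holomorphic_transform)
           (use zeros[OF True] True in \<open>auto simp: G_def S_def A1_def B1_def split: if_splits\<close>)
      moreover have "w \<in> S"
        using zeros[OF True] by (simp add: S_def B1_def)
      ultimately show ?thesis
        by (auto simp: analytic_at)
    qed
  qed
qed

text \<open>Reducing both real coordinates of u with respect to the basis 1, z modulo 1 shows that
  every value is taken on a compact parallelogram. A bounded entire function is constant by
  Liouville.\<close>

lemma elliptic_entire_constant:
  assumes G: "G holomorphic_on UNIV" and z: "Im z \<noteq> 0"
    and p1: "\<And>u. G (u + 1) = G u" and pz: "\<And>u. G (u + z) = G u"
  shows "G u = G 0"
proof -
  have p1': "G (u + of_int n) = G u" for u n
  proof (induction n rule: int_induct[of _ 0])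
    case (step1 i)
    thus ?case using p1[of "u + of_int i"] by (simp add: add_ac)
  next
    case (step2 i)
    thus ?case using p1[of "u + of_int i - 1"] by (simp add: algebra_simps)
  qed auto
  have pz': "G (u + of_int n * z) = G u" for u n
  proof (induction n rule: int_induct[of _ 0])
    case (step1 i)
    thus ?case using pz[of "u + of_int i * z"] by (simp add: algebra_simps)
  next
    case (step2 i)
    thus ?case using pz[of "u + of_int i * z - z"] by (simp add: algebra_simps)
  qed auto
  define Q where "Q = (\<lambda>(s,t). of_real s + of_real t * z) ` (cbox 0 1 \<times> cbox 0 (1::real))"
  have "compact Q"
    unfolding Q_def case_prod_unfold
    by (intro compact_continuous_image compact_Times compact_cbox continuous_intros)
  hence "compact (G ` Q)"
    by (intro compact_continuous_image holomorphic_on_imp_continuous_on holomorphic_on_subset[OF G]) auto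
  hence "bounded (G ` Q)"
    by (rule compact_imp_bounded)
  moreover have "range G \<subseteq> G ` Q"
  proof
    fix y assume "y \<in> range G"
    then obtain u where u: "y = G u" by auto
    define t where "t = Im u / Im z"
    define s where "s = Re (u - of_real t * z)"
    have "u = of_real s + of_real t * z"
      using z by (simp add: complex_eq_iff s_def t_def)
    hence "u = of_real (frac s) + of_real (frac t) * z + of_int \<lfloor>s\<rfloor> + of_int \<lfloor>t\<rfloor> * z"
      by (simp add: frac_def algebra_simps)
    hence "y = G (of_real (frac s) + of_real (frac t) * z)"
      unfolding u by (metis p1' pz')
    moreover have "of_real (frac s) + of_real (frac t) * z \<in> Q"
      unfolding Q_def by (rule image_eqI[of _ _ "(frac s, frac t)"])
        (auto simp: frac_ge_0 less_imp_le[OF frac_lt_1])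
    ultimately show "y \<in> G ` Q" by blast
  qed
  ultimately have "bounded (range G)"
    by (rule bounded_subset)
  hence "G constant_on UNIV"
    using Liouville_theorem[OF G] by blast
  thus ?thesis by (auto simp: constant_on_def)
qed

section \<open>Exponentials of the form e(r u)\<close>

lemma norm_qexp_less_one: "Im z > 0 \<Longrightarrow> norm (qexp 1 z) < 1"
  by (simp add: qexp_def)

lemma qexp_add: "qexp r (u + v) = qexp r u * qexp r v"
  by (simp add: qexp_def algebra_simps exp_add)

lemma qexp_minus: "qexp r (- u) = inverse (qexp r u)"
  by (simp add: qexp_def exp_minus)

lemma qexp_diff: "qexp r (u - v) = qexp r u * inverse (qexp r v)"
  using qexp_add[of r u "- v"] by (simp add: qexp_minus)

lemma qexp_nonzero: "qexp r u \<noteq> 0"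
  by (simp add: qexp_def)

lemma qexp_power: "qexp r u ^ n = qexp r (of_nat n * u)"
  by (simp add: qexp_def exp_of_nat_mult[symmetric] mult_ac)

lemma qexp_eq_1_iff: "qexp 1 u = 1 \<longleftrightarrow> (\<exists>m::int. u = of_int m)"
proof -
  have "qexp 1 u = 1 \<longleftrightarrow> (\<exists>m::int. 2 * of_real pi * \<i> * u = 2 * of_real pi * \<i> * of_int m)"
    using exp_eq[of "2 * of_real pi * \<i> * u" 0]
    by (simp add: qexp_def mult_ac)
  thus ?thesis by simp
qed

lemma qexp_1: "qexp 1 1 = 1"
  by (subst qexp_eq_1_iff) (rule exI[of _ 1], simp)

section \<open>The normalised theta function and Klein forms\<close>

text \<open>This is \<open>2\<pi>\<i>\<close> times the quotient of the Jacobi theta function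
  \<open>\<theta>\<^sub>1(u, z)\<close> by its \<open>u\<close>-derivative at \<open>0\<close>.\<close>

definition norm_theta :: "complex \<Rightarrow> complex \<Rightarrow> complex" where
  "norm_theta u z = 2 * \<i> * sin (of_real pi * u) *
     (qpoch_inf (qexp 1 u * qexp 1 z) (qexp 1 z) * qpoch_inf (qexp 1 (-u) * qexp 1 z) (qexp 1 z)
       / qpoch_inf (qexp 1 z) (qexp 1 z) ^ 2)"

lemma sin_conv_qexp: "2 * \<i> * sin (of_real pi * u) = - qexp 1 (- u / 2) * (1 - qexp 1 u)"
proof -
  have "2 * \<i> * sin (of_real pi * u) = qexp 1 (u / 2) - qexp 1 (- u / 2)"
    by (simp add: sin_exp_eq qexp_def mult_ac)
  moreover have "qexp 1 (- u / 2) * qexp 1 u = qexp 1 (u / 2)"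
    by (simp add: qexp_add[symmetric])
  ultimately show ?thesis
    by (simp add: algebra_simps)
qed

text \<open>The sine supplies the missing factor k = 0 of the first product. This asymmetric form
  suits shifts by z and the splitting into residue classes.\<close>

lemma norm_theta_altdef:
  assumes "Im z > 0"
  shows "norm_theta u z = - qexp 1 (- u / 2) *
     (qpoch_inf (qexp 1 u) (qexp 1 z) * qpoch_inf (qexp 1 (-u) * qexp 1 z) (qexp 1 z)
       / qpoch_inf (qexp 1 z) (qexp 1 z) ^ 2)"
  using qpoch_shift[OF norm_qexp_less_one[OF assms], of "qexp 1 u"]
  by (simp add: norm_theta_def sin_conv_qexp)

lemma norm_theta_shift_1: "norm_theta (u + 1) z = - norm_theta u z"
  by (simp add: norm_theta_def qexp_add qexp_diff qexp_minus qexp_1 distrib_left sin_add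
        flip: sin_of_real cos_of_real)

text \<open>With x = e(u), the shift replaces x by x q: the first product loses the factor 1 - x and
  the second gains 1 - 1/x. Together with the change in the half-integral exponential this leaves
  the factor -1 / (x q^(1/2)).\<close>

lemma norm_theta_shift_z:
  assumes "Im z > 0"
  shows "norm_theta (u + z) z = exp (\<i> * of_real pi * (1 - 2 * u - z)) * norm_theta u z"
proof -
  define q x where "q = qexp 1 z" and "x = qexp 1 u"
  note q = norm_qexp_less_one[OF assms, folded q_def]
  have nz: "q \<noteq> 0" "x \<noteq> 0"
    by (simp_all add: q_def x_def qexp_nonzero)
  have E: "exp (\<i> * of_real pi * (1 - 2 * u - z)) = - qexp 1 (- (u + z) / 2) * qexp 1 (- u / 2)"
    by (simp add: qexp_def exp_add[symmetric] exp_diff algebra_simps)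
       (simp add: field_simps exp_add[symmetric] exp_minus)
  have "norm_theta (u + z) z = - qexp 1 (- (u + z) / 2) *
     (qpoch_inf (x * q) q * qpoch_inf (inverse x) q / qpoch_inf q q ^ 2)"
    unfolding norm_theta_altdef[OF assms]
    using nz by (simp add: qexp_add qexp_diff qexp_minus q_def x_def field_simps)
  also have "qpoch_inf (inverse x) q = (1 - inverse x) * qpoch_inf (inverse x * q) q"
    by (rule qpoch_shift[OF q])
  finally have 1: "norm_theta (u + z) z = - qexp 1 (- (u + z) / 2) * (1 - inverse x) *
     (qpoch_inf (x * q) q * qpoch_inf (inverse x * q) q / qpoch_inf q q ^ 2)"
    by simp
  have "2 * \<i> * sin (of_real pi * u) = - qexp 1 (- u / 2) * (1 - x)"
    by (simp add: sin_conv_qexp x_def)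
  moreover have "qexp 1 (- u / 2) * qexp 1 (- u / 2) = inverse x"
    by (simp add: qexp_add[symmetric] qexp_minus[symmetric] x_def)
  hence "qexp 1 (- u / 2) * (qexp 1 (- u / 2) * (1 - x)) = - (1 - inverse x)"
    using nz by (simp add: right_diff_distrib mult.assoc[symmetric])
  ultimately have "exp (\<i> * of_real pi * (1 - 2 * u - z)) * (2 * \<i> * sin (of_real pi * u))
      = - qexp 1 (- (u + z) / 2) * (1 - inverse x)"
    unfolding E by algebra
  thus ?thesis
    unfolding 1 unfolding norm_theta_def qexp_minus q_def[symmetric] x_def[symmetric]
    by (simp only: mult.assoc[symmetric])
qed

lemma norm_theta_shift:
  assumes "Im z > 0"
  shows "norm_theta (u + of_int m + of_int n * z) z =
    exp (\<i> * of_real pi * (of_int m + of_int n - 2 * of_int n * u - of_int n ^ 2 * z)) * norm_theta u z"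
proof -
  have 1: "norm_theta (u + of_int m) z = exp (\<i> * of_real pi * of_int m) * norm_theta u z" for u
  proof (induction m rule: int_induct[of _ 0])
    case (step1 i)
    thus ?case using norm_theta_shift_1[of "u + of_int i" z] by (simp add: algebra_simps exp_add)
  next
    case (step2 i)
    thus ?case using norm_theta_shift_1[of "u + of_int i - 1" z]
      by (simp add: algebra_simps exp_diff) 
  qed auto
  have 2: "norm_theta (u + of_int n * z) z =
    exp (\<i> * of_real pi * (of_int n - 2 * of_int n * u - of_int n ^ 2 * z)) * norm_theta u z" for u
  proof (induction n rule: int_induct[of _ 0])
    case (step1 i)
    have "norm_theta (u + of_int (i + 1) * z) z = norm_theta ((u + of_int i * z) + z) z"
      by (simp add: algebra_simps)
    also have "\<dots> = exp (\<i> * of_real pi * (1 - 2 * (u + of_int i * z) - z)) *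
        (exp (\<i> * of_real pi * (of_int i - 2 * of_int i * u - of_int i ^ 2 * z)) * norm_theta u z)"
      by (simp only: norm_theta_shift_z[OF assms] step1)
    finally show ?case
      unfolding mult.assoc[symmetric] exp_add[symmetric]
      by (simp add: algebra_simps power2_eq_square)
  next
    case (step2 i)
    have "norm_theta (u + of_int i * z) z = norm_theta ((u + of_int (i - 1) * z) + z) z"
      by (simp add: algebra_simps)
    also have "\<dots> = exp (\<i> * of_real pi * (1 - 2 * (u + of_int (i - 1) * z) - z)) *
        norm_theta (u + of_int (i - 1) * z) z"
      by (simp only: norm_theta_shift_z[OF assms])
    finally have "norm_theta (u + of_int (i - 1) * z) z =
        exp (- (\<i> * of_real pi * (1 - 2 * (u + of_int (i - 1) * z) - z))) * norm_theta (u + of_int i * z) z"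
      by (simp add: exp_minus)
    also have "\<dots> = exp (- (\<i> * of_real pi * (1 - 2 * (u + of_int (i - 1) * z) - z))) *
        (exp (\<i> * of_real pi * (of_int i - 2 * of_int i * u - of_int i ^ 2 * z)) * norm_theta u z)"
      by (simp only: step2)
    finally show ?case
      unfolding mult.assoc[symmetric] exp_add[symmetric]
      by (simp add: algebra_simps power2_eq_square)
  qed auto
  have "norm_theta (u + of_int m + of_int n * z) z =
      exp (\<i> * of_real pi * (of_int n - 2 * of_int n * (u + of_int m) - of_int n ^ 2 * z)) *
      (exp (\<i> * of_real pi * of_int m) * norm_theta u z)"
    by (simp only: 1 2)
  also have "\<dots> = exp (\<i> * of_real pi * (of_int n - 2 * of_int n * (u + of_int m) - of_int n ^ 2 * z) +
      \<i> * of_real pi * of_int m) * norm_theta u z"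
    by (simp add: exp_add)
  also have "exp (\<i> * of_real pi * (of_int n - 2 * of_int n * (u + of_int m) - of_int n ^ 2 * z) +
      \<i> * of_real pi * of_int m) =
    exp (\<i> * of_real pi * (of_int m + of_int n - 2 * of_int n * u - of_int n ^ 2 * z))"
    \<comment> \<open>Evaluating the multiplier at u + m instead of u changes the exponent by -2 pi
      i n m, which the exponential does not see.\<close>
    unfolding exp_eq by (rule exI[of _ "- n * m"]) (simp add: algebra_simps)
  finally show ?thesis .
qed

text \<open>The sine and the two products account for the lattice points with n = 0, n < 0 and n >
  0, respectively.\<close>

lemma norm_theta_zero_imp_lattice:
  assumes "Im z > 0" "norm_theta u z = 0"
  obtains m n :: int where "u = of_int m + of_int n * z"
proof -
  note q = norm_qexp_less_one[OF assms(1)]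
  have "qpoch_inf (qexp 1 z) (qexp 1 z) \<noteq> 0"
    by (intro qpoch_nonzero q)
  with assms(2) consider "sin (of_real pi * u) = 0"
    | "qpoch_inf (qexp 1 u * qexp 1 z) (qexp 1 z) = 0"
    | "qpoch_inf (qexp 1 (-u) * qexp 1 z) (qexp 1 z) = 0"
    by (auto simp: norm_theta_def)
  thus ?thesis
  proof cases
    case 1
    hence "qexp 1 u = 1"
      using sin_conv_qexp[of u] by (simp add: qexp_nonzero)
    then obtain m where "u = of_int m"
      by (auto simp: qexp_eq_1_iff)
    thus ?thesis using that[of m 0] by simp
  next
    case 2
    then obtain k where "qexp 1 (u + z + of_nat k * z) = 1"
      by (auto simp: qpoch_eq_0_iff[OF q] qexp_add qexp_power)
    then obtain m where "u + z + of_nat k * z = of_int m"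
      by (auto simp: qexp_eq_1_iff)
    thus ?thesis using that[of m "- int (Suc k)"] by (simp add: algebra_simps)
  next
    case 3
    then obtain k where "qexp 1 (- u + z + of_nat k * z) = 1"
      by (auto simp: qpoch_eq_0_iff[OF q] qexp_add qexp_diff qexp_minus qexp_power mult_ac)
    then obtain m where "- u + z + of_nat k * z = of_int m"
      by (auto simp: qexp_eq_1_iff)
    thus ?thesis using that[of "-m" "int (Suc k)"] by (simp add: algebra_simps)
  qed
qed

lemma norm_theta_lattice:
  assumes "Im z > 0"
  shows "norm_theta (of_int m + of_int n * z) z = 0"
  using norm_theta_shift[OF assms, of 0 m n] by (simp add: norm_theta_def)

lemma holomorphic_norm_theta:
  assumes "Im z > 0"
  shows "(\<lambda>u. norm_theta u z) holomorphic_on UNIV"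
proof -
  note q = norm_qexp_less_one[OF assms]
  have "qpoch_inf (qexp 1 z) (qexp 1 z) \<noteq> 0"
    by (intro qpoch_nonzero q)
  thus ?thesis
    unfolding norm_theta_def
    by (intro holomorphic_intros holomorphic_on_qpoch q open_UNIV)
       (auto simp: qexp_def[abs_def] intro!: holomorphic_intros)
qed

text \<open>The function is 2 i sin(pi u) times a factor \<open>R\<close> that the normalisation
  makes equal to 1 at u = 0. This derivative is what later fixes the constant in the modular
  transformation law.\<close>

lemma norm_theta_has_derivative_0:
  assumes "Im z > 0"
  shows "((\<lambda>u. norm_theta u z) has_field_derivative 2 * \<i> * of_real pi) (at 0)"
proof -
  note q = norm_qexp_less_one[OF assms]
  have nz: "qpoch_inf (qexp 1 z) (qexp 1 z) \<noteq> 0"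
    by (intro qpoch_nonzero q)
  define R where "R = (\<lambda>u. qpoch_inf (qexp 1 u * qexp 1 z) (qexp 1 z) *
      qpoch_inf (qexp 1 (-u) * qexp 1 z) (qexp 1 z) / qpoch_inf (qexp 1 z) (qexp 1 z) ^ 2)"
  have "R holomorphic_on UNIV"
    unfolding R_def using nz
    by (intro holomorphic_intros holomorphic_on_qpoch q open_UNIV)
       (auto simp: qexp_def[abs_def] intro!: holomorphic_intros)
  then obtain R' where R': "(R has_field_derivative R') (at 0)"
    by (auto simp: holomorphic_on_def field_differentiable_def)
  have "R 0 = 1"
    using nz by (simp add: R_def qexp_def power2_eq_square)
  have "((\<lambda>u. 2 * \<i> * sin (of_real pi * u) * R u) has_field_derivative 2 * \<i> * of_real pi) (at 0)"
    by (rule derivative_eq_intros R' refl)+ (simp add: \<open>R 0 = 1\<close>)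
  thus ?thesis
    by (simp add: norm_theta_def R_def)
qed

text \<open>The zero at the origin is simple, and the quasi-periodicity carries it to every lattice
  point with a multiplier that never vanishes.\<close>

lemma deriv_norm_theta_lattice:
  assumes "Im z > 0"
  shows "deriv (\<lambda>u. norm_theta u z) (of_int m + of_int n * z) \<noteq> 0"
proof -
  define w where "w = of_int m + of_int n * z"
  define E where "E = (\<lambda>u. exp (\<i> * of_real pi *
      (of_int m + of_int n - 2 * of_int n * u - of_int n ^ 2 * z)))"
  have E': "(E has_field_derivative E 0 * (\<i> * of_real pi * (- 2 * of_int n))) (at 0)"
    unfolding E_def by (auto intro!: derivative_eq_intros)
  have "((\<lambda>u. E u * norm_theta u z) has_field_derivative E 0 * (2 * \<i> * of_real pi)) (at 0)"
    by (rule derivative_eq_intros E' norm_theta_has_derivative_0 assms refl)+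
       (simp add: norm_theta_def)
  also have "(\<lambda>u. E u * norm_theta u z) = (\<lambda>u. norm_theta (u + w) z)"
    using norm_theta_shift[OF assms, of _ m n] by (simp add: E_def w_def add.assoc)
  finally have "((\<lambda>u. norm_theta u z) has_field_derivative E 0 * (2 * \<i> * of_real pi)) (at w)"
    using DERIV_shift[of "\<lambda>u. norm_theta u z" _ 0 w] by simp
  thus ?thesis
    by (simp add: DERIV_imp_deriv w_def E_def)
qed

section \<open>Modular transformation of the theta function\<close>

lemma exp_pi_i_even:
  assumes "even n"
  shows "exp (\<i> * of_real pi * of_int n) = 1"
proof -
  from assms obtain k where "n = 2 * k" by blast
  thus ?thesis using exp_eq[of "\<i> * of_real pi * of_int n" 0]
    by (auto simp: mult_ac)
qed

lemma exp_pi_i_odd: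
  assumes "odd n"
  shows "exp (\<i> * of_real pi * of_int n) = -1"
proof -
  have "exp (\<i> * of_real pi * of_int (n - 1)) = 1"
    by (rule exp_pi_i_even) (use assms in auto)
  hence "- exp (\<i> * of_real pi * of_int n) = 1"
    by (simp add: right_diff_distrib exp_diff)
  thus ?thesis by (simp only: minus_equation_iff[of _ 1])
qed

lemma Im_moebius:
  fixes a b c d :: int
  assumes "a * d - b * c = 1" "Im z > 0"
  shows "of_int c * z + of_int d \<noteq> 0"
    and "Im ((of_int a * z + of_int b) / (of_int c * z + of_int d))
           = Im z / norm (of_int c * z + of_int d) ^ 2"
    and "Im ((of_int a * z + of_int b) / (of_int c * z + of_int d)) > 0"
proof -
  show nz: "of_int c * z + of_int d \<noteq> 0"
    using assms by (auto simp: complex_eq_iff)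
  have det: "real_of_int a * d - real_of_int b * c = 1"
    using assms(1) by (metis of_int_1 of_int_diff of_int_mult)
  have "real_of_int a * Im z * (real_of_int c * Re z + real_of_int d)
      - (real_of_int a * Re z + real_of_int b) * (real_of_int c * Im z)
      = (real_of_int a * d - real_of_int b * c) * Im z"
    by (simp add: algebra_simps)
  thus eq: "Im ((of_int a * z + of_int b) / (of_int c * z + of_int d))
           = Im z / norm (of_int c * z + of_int d) ^ 2"
    by (simp add: Im_divide cmod_power2 det)
  show "Im ((of_int a * z + of_int b) / (of_int c * z + of_int d)) > 0"
    unfolding eq using nz assms(2) by simp
qed

text \<open>Both sides are entire in \<open>u\<close> with simple zeros on the same lattice and the same multipliers,
  so their quotient is an entire elliptic function.\<close>

theorem norm_theta_moebius:
  fixes a b c d :: int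
  assumes det: "a * d - b * c = 1" and z: "Im z > 0"
  defines "j \<equiv> of_int c * z + of_int d"
  shows "norm_theta (u / j) ((of_int a * z + of_int b) / j)
       = exp (\<i> * of_real pi * of_int c * u ^ 2 / j) / j * norm_theta u z"
proof -
  define t where "t = (of_int a * z + of_int b) / j"
  have j: "j \<noteq> 0" and t: "Im t > 0"
    using Im_moebius[OF det z] by (auto simp: j_def t_def)
  have det': "of_int a * of_int d - of_int b * of_int c = (1 :: complex)"
    using det by (metis of_int_1 of_int_diff of_int_mult)
  have jt: "t * j = of_int a * z + of_int b"
    using j by (simp add: t_def)
  define A where "A = (\<lambda>u. norm_theta (u / j) t * exp (- (\<i> * of_real pi * of_int c * u ^ 2 / j)))"
  define B where "B = (\<lambda>u. norm_theta u z)"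
  have hB: "B holomorphic_on UNIV"
    unfolding B_def by (rule holomorphic_norm_theta[OF z])
  have "(\<lambda>u. norm_theta u t) \<circ> (\<lambda>u. u / j) holomorphic_on UNIV"
    by (rule holomorphic_on_compose_gen[OF _ holomorphic_norm_theta[OF t]])
       (use j in \<open>auto intro!: holomorphic_intros\<close>)
  hence hA: "A holomorphic_on UNIV"
    unfolding A_def o_def using j by (intro holomorphic_intros) auto
  \<comment> \<open>The lattice spanned by 1 and z is j times the lattice spanned by 1 and t:
    determinant 1 gives 1 = (a - c t) j and z = (d t - b) j. Periods of B thus become lattice shifts
    of u / j.\<close>
  have lat1: "(u + 1) / j = u / j + of_int a + of_int (- c) * t" for u
  proof -
    have "(u / j + of_int a + of_int (- c) * t) * j = u + of_int a * j - of_int c * (t * j)"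
      using j by (simp add: algebra_simps)
    also have "\<dots> = u + 1"
      using det' unfolding jt unfolding j_def by algebra
    finally show ?thesis unfolding nonzero_divide_eq_eq[OF j] by (rule sym)
  qed
  have latz: "(u + z) / j = u / j + of_int (- b) + of_int d * t" for u
  proof -
    have "(u / j + of_int (- b) + of_int d * t) * j = u - of_int b * j + of_int d * (t * j)"
      using j by (simp add: algebra_simps)
    also have "\<dots> = u + z"
      using det' unfolding jt unfolding j_def by algebra
    finally show ?thesis unfolding nonzero_divide_eq_eq[OF j] by (rule sym)
  qed
  have zeros: "A w = 0 \<and> deriv B w \<noteq> 0" if "B w = 0" for w
  proof -
    obtain m n :: int where w: "w = of_int m + of_int n * z"
      using norm_theta_zero_imp_lattice[OF z] \<open>B w = 0\<close> unfolding B_def by metis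
    have "w / j = of_int (m * a - n * b) + of_int (n * d - m * c) * t"
    proof -
      have "(of_int (m * a - n * b) + of_int (n * d - m * c) * t) * j
          = (of_int m * of_int a - of_int n * of_int b) * j + (of_int n * of_int d - of_int m * of_int c) * (t * j)"
        by (simp add: algebra_simps)
      also have "\<dots> = w"
        using det' unfolding jt unfolding w j_def by algebra
      finally show ?thesis unfolding nonzero_divide_eq_eq[OF j] by (rule sym)
    qed
    hence "A w = 0"
      unfolding A_def by (simp only: norm_theta_lattice[OF t] mult_zero_left)
    moreover have "deriv B w \<noteq> 0"
      unfolding B_def w by (rule deriv_norm_theta_lattice[OF z])
    ultimately show ?thesis ..
  qed
  have A1: "A (u + 1) = - A u" for u
  proof -
    \<comment> \<open>Modulo 2 this number is (1 + a)(1 + c) - 1, and determinant 1 forbids a and c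
      to be both even.\<close>
    have odd: "odd (a - c - a * c)"
    proof -
      have "odd (a * d - b * c)" using det by simp
      thus ?thesis by auto
    qed
    \<comment> \<open>The Gaussian factor in \<open>A\<close> is made to cancel the terms linear in
      u of the shift law. The remaining constants combine through c^2 t + c / j = a c to an odd
      multiple of pi i.\<close>
    have e: "\<i> * of_real pi * (of_int a + of_int (- c) - 2 * of_int (- c) * (u / j) - of_int (- c) ^ 2 * t)
        - \<i> * of_real pi * of_int c * (u + 1) ^ 2 / j
        = \<i> * of_real pi * of_int (a - c - a * c) + - (\<i> * of_real pi * of_int c * u ^ 2 / j)"
    proof -
      have "of_int c ^ 2 * (t * j) + of_int c = of_int a * of_int c * j"
        using det' unfolding jt unfolding j_def by algebra
      hence "of_int c ^ 2 * t + of_int c / j = of_int a * of_int c"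
        using j by (simp add: field_simps)
      moreover have "of_int c * (u + 1) ^ 2 / j = of_int c * u ^ 2 / j + 2 * of_int c * (u / j) + of_int c / j"
        using j by (simp add: field_simps power2_eq_square)
      ultimately have "(of_int a + of_int (- c) - 2 * of_int (- c) * (u / j) - of_int (- c) ^ 2 * t)
        - of_int c * (u + 1) ^ 2 / j = of_int (a - c - a * c) - of_int c * u ^ 2 / j"
        by (simp add: algebra_simps)
      hence "\<i> * of_real pi * ((of_int a + of_int (- c) - 2 * of_int (- c) * (u / j) - of_int (- c) ^ 2 * t)
        - of_int c * (u + 1) ^ 2 / j) = \<i> * of_real pi * (of_int (a - c - a * c) - of_int c * u ^ 2 / j)"
        by (simp only:)
      thus ?thesis
        by (simp only: right_diff_distrib times_divide_eq_right mult.assoc diff_conv_add_uminus[symmetric])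
    qed
    have "A (u + 1) = exp (\<i> * of_real pi * (of_int a + of_int (- c) - 2 * of_int (- c) * (u / j)
        - of_int (- c) ^ 2 * t) - \<i> * of_real pi * of_int c * (u + 1) ^ 2 / j) * norm_theta (u / j) t"
      unfolding A_def lat1 norm_theta_shift[OF t] by (simp only: exp_diff exp_minus) (simp add: field_simps)
    thus ?thesis
      unfolding e exp_add exp_pi_i_odd[OF odd] A_def by simp
  qed
  have Az: "A (u + z) = exp (\<i> * of_real pi * (1 - 2 * u - z)) * A u" for u
  proof -
    have odd: "odd (d - b - b * d)"
    proof -
      have "odd (a * d - b * c)" using det by simp
      thus ?thesis by auto
    qed
    \<comment> \<open>The same cancellation for the period z: the part depending on u and z agrees
      with the multiplier of B, up to an odd multiple of pi i.\<close>
    have e: "\<i> * of_real pi * (of_int (- b) + of_int d - 2 * of_int d * (u / j) - of_int d ^ 2 * t)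
        - \<i> * of_real pi * of_int c * (u + z) ^ 2 / j
        = \<i> * of_real pi * of_int (d - b - b * d) +
          (\<i> * of_real pi * (- 2 * u - z) + - (\<i> * of_real pi * of_int c * u ^ 2 / j))"
    proof -
      have "of_int d ^ 2 * (t * j) + of_int c * z ^ 2 = (z + of_int b * of_int d) * j"
        using det' unfolding jt unfolding j_def by algebra
      hence 1: "of_int d ^ 2 * t + of_int c * z ^ 2 / j = z + of_int b * of_int d"
        using j by (simp add: field_simps)
      have 2: "2 * of_int d * (u / j) + 2 * of_int c * u * z / j = 2 * u"
        using j by (simp add: field_simps) (simp add: j_def algebra_simps)
      have 3: "of_int c * (u + z) ^ 2 / j = of_int c * u ^ 2 / j + 2 * of_int c * u * z / j + of_int c * z ^ 2 / j"
        using j by (simp add: field_simps power2_eq_square)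
      have "(of_int (- b) + of_int d - 2 * of_int d * (u / j) - of_int d ^ 2 * t) - of_int c * (u + z) ^ 2 / j
        = of_int d - of_int b - (2 * of_int d * (u / j) + 2 * of_int c * u * z / j)
          - (of_int d ^ 2 * t + of_int c * z ^ 2 / j) - of_int c * u ^ 2 / j"
        unfolding 3 by simp
      also have "\<dots> = of_int (d - b - b * d) + ((- 2 * u - z) - of_int c * u ^ 2 / j)"
        unfolding 1 2 by simp
      finally have "\<i> * of_real pi * ((of_int (- b) + of_int d - 2 * of_int d * (u / j) - of_int d ^ 2 * t)
        - of_int c * (u + z) ^ 2 / j)
        = \<i> * of_real pi * (of_int (d - b - b * d) + ((- 2 * u - z) - of_int c * u ^ 2 / j))"
        by (simp only:)
      thus ?thesis
        by (simp only: right_diff_distrib distrib_left times_divide_eq_right mult.assoc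
              diff_conv_add_uminus[symmetric])
    qed
    have "A (u + z) = exp (\<i> * of_real pi * (of_int (- b) + of_int d - 2 * of_int d * (u / j)
        - of_int d ^ 2 * t) - \<i> * of_real pi * of_int c * (u + z) ^ 2 / j) * norm_theta (u / j) t"
      unfolding A_def latz norm_theta_shift[OF t] by (simp only: exp_diff exp_minus) (simp add: field_simps)
    also have "\<dots> = - exp (\<i> * of_real pi * (- 2 * u - z)) * A u"
      unfolding e exp_add exp_pi_i_odd[OF odd] A_def by simp
    also have "- exp (\<i> * of_real pi * (- 2 * u - z)) = exp (\<i> * of_real pi * (1 - 2 * u - z))"
    proof -
      have "\<i> * of_real pi * (1 - 2 * u - z) = \<i> * of_real pi + \<i> * of_real pi * (- 2 * u - z)"
        by (simp add: algebra_simps)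
      thus ?thesis by (simp only: exp_add) simp
    qed
    finally show ?thesis .
  qed
  obtain G where G: "G holomorphic_on UNIV" and AGB: "\<And>u. A u = G u * B u"
    using holomorphic_quotient[OF hA hB zeros] by blast
  have hshift: "(\<lambda>u. G (u + w)) holomorphic_on UNIV" for w
  proof -
    have "(\<lambda>u. u + w) holomorphic_on UNIV"
      by (intro holomorphic_intros)
    thus ?thesis
      using holomorphic_on_compose_gen[OF _ G, of "\<lambda>u. u + w" UNIV] by (simp add: o_def)
  qed
  define S where "S = {u. B u \<noteq> 0}"
  have S: "open S" "S \<noteq> {}"
  proof -
    show "open S"
      unfolding S_def by (intro open_Collect_neq continuous_intros holomorphic_on_imp_continuous_on hB)
    have "B = (\<lambda>_. 0)" if "S = {}"
      using that by (auto simp: S_def)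
    hence "deriv B 0 = 0" if "S = {}"
      using that by simp
    thus "S \<noteq> {}"
      using DERIV_imp_deriv[OF norm_theta_has_derivative_0[OF z]] by (auto simp: B_def)
  qed
  \<comment> \<open>Where B is nonzero, equal multipliers of A and B cancel in the quotient. The
    identity theorem extends the periodicity to the zeros, since \<open>S\<close> is open and
    nonempty.\<close>
  have period: "G (u + w) = G u"
    if "\<And>u. A (u + w) = f u * A u" "\<And>u. B (u + w) = f u * B u" "\<And>u. f u \<noteq> 0" for f w u
  proof (rule analytic_continuation_open[OF S(1) open_UNIV S(2) connected_UNIV subset_UNIV hshift G])
    show "G (u + w) = G u" if "u \<in> S" for u
      using AGB[of "u + w"] AGB[of u] \<open>\<And>u. A (u + w) = f u * A u\<close> \<open>\<And>u. B (u + w) = f u * B u\<close>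
        \<open>\<And>u. f u \<noteq> 0\<close> that by (simp add: S_def)
  qed auto
  have G1: "G (u + 1) = G u" for u
    by (rule period[of 1 "\<lambda>_. -1"]) (simp_all add: A1 B_def norm_theta_shift_1)
  have Gz: "G (u + z) = G u" for u
    by (rule period[of z "\<lambda>u. exp (\<i> * of_real pi * (1 - 2 * u - z))"])
       (simp_all add: Az B_def norm_theta_shift_z[OF z])
  have const: "G u = G 0" for u
    by (rule elliptic_entire_constant[OF G _ G1 Gz]) (use z in auto)
  \<comment> \<open>Comparing derivatives at 0: A has 2 pi i / j there and B has 2 pi i, while the
    Gaussian has derivative 0.\<close>
  have "G 0 = 1 / j"
  proof -
    have "((\<lambda>u. norm_theta u t) has_field_derivative 2 * \<i> * of_real pi) (at (0 / j))"
      using norm_theta_has_derivative_0[OF t] by simp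
    hence "((\<lambda>u. norm_theta (u / j) t) has_field_derivative 2 * \<i> * of_real pi * (1 / j)) (at 0)"
      by (rule DERIV_chain2) (use j in \<open>auto intro!: derivative_eq_intros\<close>)
    moreover have "((\<lambda>u. exp (- (\<i> * of_real pi * of_int c * u ^ 2 / j))) has_field_derivative 0) (at 0)"
      using j by (auto intro!: derivative_eq_intros)
    ultimately have "(A has_field_derivative 2 * \<i> * of_real pi * (1 / j)) (at 0)"
      unfolding A_def using j by (auto intro!: derivative_eq_intros)
    moreover have "(A has_field_derivative G 0 * (2 * \<i> * of_real pi)) (at 0)"
    proof -
      have "A = (\<lambda>u. G 0 * norm_theta u z)"
        using AGB const by (auto simp: B_def)
      thus ?thesis using DERIV_cmult[OF norm_theta_has_derivative_0[OF z], of "G 0"] by simp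
    qed
    ultimately have "2 * \<i> * of_real pi * (1 / j) = G 0 * (2 * \<i> * of_real pi)"
      by (rule DERIV_unique)
    thus ?thesis using j by (simp add: field_simps)
  qed
  hence "norm_theta (u / j) t * exp (- (\<i> * of_real pi * of_int c * u ^ 2 / j)) = 1 / j * norm_theta u z"
    using AGB[of u] const[of u] by (simp add: A_def B_def)
  thus ?thesis
    unfolding t_def using j by (simp add: exp_minus field_simps)
qed

text \<open>Up to the factor \<open>2\<pi>\<i>\<close>, this is the classical Klein form of weight \<open>-1\<close> with
  characteristic \<open>(\<alpha>, \<beta>)\<close>.\<close>

definition klein :: "complex \<Rightarrow> complex \<Rightarrow> complex \<Rightarrow> complex" where
  "klein \<alpha> \<beta> z = exp (\<i> * of_real pi * \<alpha> * (\<alpha> * z + \<beta>)) * norm_theta (\<alpha> * z + \<beta>) z"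

text \<open>The exponential prefactor absorbs the Gaussian of the theta law, because \<alpha> + c u
  = (\<alpha> a + \<beta> c)(c z + d) for the transformed argument u. What remains is right
  multiplication of the row vector (\<alpha>, \<beta>) by the matrix.\<close>

lemma klein_moebius:
  fixes a b c d :: int
  assumes det: "a * d - b * c = 1" and z: "Im z > 0"
  shows "klein \<alpha> \<beta> ((of_int a * z + of_int b) / (of_int c * z + of_int d)) =
    klein (\<alpha> * of_int a + \<beta> * of_int c) (\<alpha> * of_int b + \<beta> * of_int d) z / (of_int c * z + of_int d)"
proof -
  define j where "j = of_int c * z + of_int d"
  define t where "t = (of_int a * z + of_int b) / j"
  define u where "u = (\<alpha> * of_int a + \<beta> * of_int c) * z + (\<alpha> * of_int b + \<beta> * of_int d)"
  have j: "j \<noteq> 0"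
    using Im_moebius[OF det z] by (auto simp: j_def)
  have u: "\<alpha> * t + \<beta> = u / j"
    using j unfolding t_def u_def by (simp add: field_simps) (simp add: j_def algebra_simps)
  have det': "of_int a * of_int d - of_int b * of_int c = (1 :: complex)"
    using det by (metis of_int_1 of_int_diff of_int_mult)
  have "\<alpha> + of_int c * u = (\<alpha> * of_int a + \<beta> * of_int c) * j"
    using det' unfolding u_def j_def by algebra
  hence "(\<alpha> + of_int c * u) * u / j = (\<alpha> * of_int a + \<beta> * of_int c) * u"
    using j by (simp add: field_simps)
  hence "\<i> * of_real pi * ((\<alpha> + of_int c * u) * u / j) = \<i> * of_real pi * ((\<alpha> * of_int a + \<beta> * of_int c) * u)"
    by (simp only:)
  hence "\<i> * of_real pi * \<alpha> * (u / j) + \<i> * of_real pi * of_int c * u ^ 2 / j =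
      \<i> * of_real pi * (\<alpha> * of_int a + \<beta> * of_int c) * u"
    using j by (simp add: field_simps power2_eq_square)
  thus ?thesis
    using norm_theta_moebius[OF det z, of u] j
    unfolding klein_def u_def[symmetric] j_def[symmetric] t_def[symmetric] u
    by (simp add: exp_add[symmetric])
qed

text \<open>All terms involving z cancel between the prefactor and the theta multiplier. For
  rational characteristics the remaining constant is a root of unity.\<close>

lemma klein_shift:
  assumes "Im z > 0"
  shows "klein (\<alpha> + of_int m) (\<beta> + of_int n) z =
    exp (\<i> * of_real pi * (of_int (m + n + m * n) + \<alpha> * of_int n - \<beta> * of_int m)) * klein \<alpha> \<beta> z"
proof -
  have "(\<alpha> + of_int m) * z + (\<beta> + of_int n) = (\<alpha> * z + \<beta>) + of_int n + of_int m * z"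
    by (simp add: algebra_simps)
  thus ?thesis
    unfolding klein_def
    by (simp only: norm_theta_shift[OF assms] mult.assoc[symmetric] exp_add[symmetric])
       (simp add: algebra_simps power2_eq_square)
qed

section \<open>The crank form as a product of Klein forms\<close>

text \<open>Pairing s with 2 r + 1 - s mirrors the two products in the theta function, whose
  arguments u and -u give opposite residues.\<close>

lemma prod_pairing:
  fixes F :: "nat \<Rightarrow> 'a :: comm_monoid_mult"
  shows "(\<Prod>s<2*r+1. F s) = F 0 * (\<Prod>s=1..r. F s * F (2*r+1-s))"
proof -
  have "{..<2*r+1} = {0} \<union> ({1..r} \<union> {r+1..2*r})"
    by auto
  hence "(\<Prod>s<2*r+1. F s) = F 0 * ((\<Prod>s=1..r. F s) * (\<Prod>s=r+1..2*r. F s))"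
    by (simp add: prod.union_disjoint)
  also have "(\<Prod>s=r+1..2*r. F s) = (\<Prod>s=1..r. F (2*r+1-s))"
    by (rule prod.reindex_bij_witness[of _ "\<lambda>s. 2*r+1-s" "\<lambda>s. 2*r+1-s"]) auto
  finally show ?thesis
    by (simp add: prod.distrib)
qed

definition euler_prod :: "complex \<Rightarrow> complex" where
  "euler_prod z = qpoch_inf (qexp 1 z) (qexp 1 z)"

lemma euler_prod_nonzero: "Im z > 0 \<Longrightarrow> euler_prod z \<noteq> 0"
  unfolding euler_prod_def by (intro qpoch_nonzero norm_qexp_less_one)

lemma dedekind_eta_conv_euler_prod: "dedekind_eta z = qexp (1/24) z * euler_prod z"
  by (simp add: dedekind_eta_def euler_prod_def qpoch_inf_def)

text \<open>The product over all p-th roots of unity is the Euler product at p w. The root 1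
  contributes the Euler product at w, and the other roots occur in inverse pairs.\<close>

lemma prod_qpoch_roots_of_unity:
  assumes "Im w > 0" and p: "p = 2 * r + 1"
  shows "(\<Prod>s=1..r. qpoch_inf (qexp 1 (of_nat s / of_nat p) * qexp 1 w) (qexp 1 w)
            * qpoch_inf (qexp 1 (- (of_nat s / of_nat p)) * qexp 1 w) (qexp 1 w))
         = euler_prod (of_nat p * w) / euler_prod w"
proof -
  have p0: "p > 0"
    by (simp add: p)
  have root: "exp (2 * pi * \<i> / of_nat p) ^ s = qexp 1 (of_nat s / of_nat p)" for s
    by (simp add: qexp_def exp_of_nat_mult[symmetric] mult_ac)
  have refl_root: "qexp 1 (of_nat (p - s) / of_nat p) = qexp 1 (- (of_nat s / of_nat p))"
    if "s \<in> {1..r}" for s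
  proof -
    have "of_nat (p - s) / of_nat p = (1 - of_nat s / of_nat p :: complex)"
    proof -
      have "s < p" using that p by auto
      thus ?thesis by (simp add: of_nat_diff field_simps)
    qed
    thus ?thesis by (simp add: qexp_diff qexp_minus qexp_1)
  qed
  have "euler_prod (of_nat p * w) = (\<Prod>s<p. qpoch_inf (qexp 1 (of_nat s / of_nat p) * qexp 1 w) (qexp 1 w))"
    using qpoch_roots_of_unity[OF norm_qexp_less_one[OF assms(1)], of p "qexp 1 w", unfolded root] p0
    by (simp add: euler_prod_def qexp_power)
  also have "\<dots> = qpoch_inf (qexp 1 (of_nat 0 / of_nat p) * qexp 1 w) (qexp 1 w) *
      (\<Prod>s=1..r. qpoch_inf (qexp 1 (of_nat s / of_nat p) * qexp 1 w) (qexp 1 w) *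
          qpoch_inf (qexp 1 (of_nat (p - s) / of_nat p) * qexp 1 w) (qexp 1 w))"
    unfolding p by (rule prod_pairing)
  also have "qpoch_inf (qexp 1 (of_nat 0 / of_nat p) * qexp 1 w) (qexp 1 w) = euler_prod w"
    by (simp add: euler_prod_def qexp_def)
  also have "(\<Prod>s=1..r. qpoch_inf (qexp 1 (of_nat s / of_nat p) * qexp 1 w) (qexp 1 w) *
          qpoch_inf (qexp 1 (of_nat (p - s) / of_nat p) * qexp 1 w) (qexp 1 w)) =
      (\<Prod>s=1..r. qpoch_inf (qexp 1 (of_nat s / of_nat p) * qexp 1 w) (qexp 1 w)
            * qpoch_inf (qexp 1 (- (of_nat s / of_nat p)) * qexp 1 w) (qexp 1 w))"
    by (intro prod.cong refl) (simp only: refl_root)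
  finally show ?thesis
    using euler_prod_nonzero[OF assms(1)] by (simp add: field_simps)
qed

lemma prod_qpoch_progression:
  assumes "Im z > 0" and p: "p = 2 * r + 1"
  shows "(\<Prod>s=1..r. qpoch_inf (qexp 1 (of_nat s * z)) (qexp 1 (of_nat p * z))
            * qpoch_inf (qexp 1 (- (of_nat s * z)) * qexp 1 (of_nat p * z)) (qexp 1 (of_nat p * z)))
         = euler_prod z / euler_prod (of_nat p * z)"
proof -
  have w: "Im (of_nat p * z) > 0"
    using assms by simp
  define q where "q = qexp 1 z"
  \<comment> \<open>The exponents in the Euler product run over 1, ..., p rather than 0, ..., p - 1.
    The exponent p is therefore stored at index 0, so that the pairing s, p - s applies to the
    rest.\<close>
  define F where "F = (\<lambda>s. qpoch_inf (if s = 0 then q ^ p else q ^ s) (q ^ p))"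
  have Q: "qexp 1 (of_nat p * z) = q ^ p"
    by (simp add: q_def qexp_power)
  have "euler_prod z = (\<Prod>s<Suc (2 * r). qpoch_inf (q * q ^ s) (q ^ p))"
    using qpoch_progression[OF norm_qexp_less_one[OF assms(1)], of p "qexp 1 z"] p
    by (simp add: euler_prod_def q_def)
  also have "\<dots> = (\<Prod>s<2 * r. F (Suc s)) * F 0"
    by (simp add: F_def p)
  also have "\<dots> = (\<Prod>s<2*r+1. F s)"
    by (simp only: Suc_eq_plus1[symmetric] prod.lessThan_Suc_shift mult.commute)
  also have "\<dots> = F 0 * (\<Prod>s=1..r. F s * F (2*r+1-s))"
    by (rule prod_pairing)
  also have "F 0 = euler_prod (of_nat p * z)"
    by (simp add: F_def euler_prod_def Q)
  also have "(\<Prod>s=1..r. F s * F (2*r+1-s)) =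
      (\<Prod>s=1..r. qpoch_inf (qexp 1 (of_nat s * z)) (qexp 1 (of_nat p * z))
            * qpoch_inf (qexp 1 (- (of_nat s * z)) * qexp 1 (of_nat p * z)) (qexp 1 (of_nat p * z)))"
  proof (intro prod.cong refl)
    fix s assume s: "s \<in> {1..r}"
    have "qexp 1 (- (of_nat s * z)) * qexp 1 (of_nat p * z) = q ^ (p - s)"
      using s p unfolding qexp_add[symmetric] q_def qexp_power by (simp add: of_nat_diff algebra_simps)
    moreover have "F s = qpoch_inf (qexp 1 (of_nat s * z)) (q ^ p)"
      using s by (simp add: F_def q_def qexp_power)
    moreover have "F (p - s) = qpoch_inf (q ^ (p - s)) (q ^ p)"
      using s p by (simp add: F_def)
    ultimately show "F s * F (2*r+1-s) = qpoch_inf (qexp 1 (of_nat s * z)) (qexp 1 (of_nat p * z))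
            * qpoch_inf (qexp 1 (- (of_nat s * z)) * qexp 1 (of_nat p * z)) (qexp 1 (of_nat p * z))"
      unfolding p[symmetric] Q by simp
  qed
  finally show ?thesis
    using euler_prod_nonzero[OF w] by (simp add: field_simps)
qed

lemma sum_squares_upto: "6 * (\<Sum>s=1..r. s ^ 2) = r * (r + 1) * (2 * r + 1)" for r :: nat
  by (induction r) (auto simp: algebra_simps power2_eq_square)

lemma sum_upto: "2 * (\<Sum>s=1..r. s) = r * (r + 1)" for r :: nat
  by (induction r) auto

text \<open>The prefactor is 1 for a zero first characteristic, and the sines do not depend on z.
  The denominators contribute 2 r Euler products at p z and the root-of-unity product one more, p in
  total.\<close>

lemma prod_klein_column:
  assumes "Im z > 0" and p: "p = 2 * r + 1"
  shows "(\<Prod>s=1..r. klein 0 (of_nat s / of_nat p) (of_nat p * z)) =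
     (\<Prod>s=1..r. 2 * \<i> * sin (of_real pi * (of_nat s / of_nat p))) *
     (euler_prod (of_nat (p ^ 2) * z) / euler_prod (of_nat p * z) ^ p)"
proof -
  define w where "w = of_nat p * z"
  have w: "Im w > 0"
    using assms by (simp add: w_def)
  have "(\<Prod>s=1..r. klein 0 (of_nat s / of_nat p) w) =
     (\<Prod>s=1..r. 2 * \<i> * sin (of_real pi * (of_nat s / of_nat p))) *
     (\<Prod>s=1..r. qpoch_inf (qexp 1 (of_nat s / of_nat p) * qexp 1 w) (qexp 1 w)
            * qpoch_inf (qexp 1 (- (of_nat s / of_nat p)) * qexp 1 w) (qexp 1 w)) /
     (euler_prod w ^ 2) ^ r"
    unfolding klein_def norm_theta_def euler_prod_def
    by (simp add: prod.distrib prod_dividef)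
  moreover have "euler_prod w ^ p = euler_prod w * (euler_prod w ^ 2) ^ r"
    by (simp add: p power_mult)
  ultimately show ?thesis
    unfolding prod_qpoch_roots_of_unity[OF w p]
    by (simp add: w_def power2_eq_square mult.assoc)
qed

text \<open>The sign of \<open>norm_theta_altdef\<close> occurs r times. The power of q comes from
  the sum of s^2 / p - s, which is r (r + 1) / 6 - r (r + 1) / 2 = -(p^2 - 1) / 12.\<close>

lemma prod_klein_row:
  assumes "Im z > 0" and p: "p = 2 * r + 1"
  shows "(\<Prod>s=1..r. klein (of_nat s / of_nat p) 0 (of_nat p * z)) =
     (-1) ^ r * qexp (- (real p ^ 2 - 1) / 24) z * (euler_prod z / euler_prod (of_nat p * z) ^ p)"
proof -
  define w where "w = of_nat p * z"
  have w: "Im w > 0"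
    using assms by (simp add: w_def)
  \<comment> \<open>The term s^2 / p stems from the Klein prefactor at p z, the term -s from the
    half-integral exponential of the theta function.\<close>
  define e where "e = (\<lambda>s::nat. \<i> * of_real pi * z * (of_nat (s ^ 2) / of_nat p - of_nat s))"
  have "klein (of_nat s / of_nat p) 0 w = (-1) * (exp (e s) *
      (qpoch_inf (qexp 1 (of_nat s * z)) (qexp 1 w)
            * qpoch_inf (qexp 1 (- (of_nat s * z)) * qexp 1 w) (qexp 1 w) / euler_prod w ^ 2))" for s
  proof -
    have arg: "of_nat s / of_nat p * w + 0 = of_nat s * z"
      by (simp add: w_def p del: of_nat_Suc of_nat_add)
    have "exp (\<i> * of_real pi * (of_nat s / of_nat p) * (of_nat s * z)) * qexp 1 (- (of_nat s * z) / 2) = exp (e s)"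
      by (simp add: qexp_def e_def exp_add[symmetric] algebra_simps power2_eq_square)
    thus ?thesis
      unfolding klein_def arg norm_theta_altdef[OF w] euler_prod_def
      by (simp add: mult.assoc[symmetric])
  qed
  hence "(\<Prod>s=1..r. klein (of_nat s / of_nat p) 0 w) = (\<Prod>s=1..r. -1) * ((\<Prod>s=1..r. exp (e s)) *
      ((\<Prod>s=1..r. qpoch_inf (qexp 1 (of_nat s * z)) (qexp 1 w)
            * qpoch_inf (qexp 1 (- (of_nat s * z)) * qexp 1 w) (qexp 1 w)) / (\<Prod>s=1..r. euler_prod w ^ 2)))"
    by (simp only: prod.distrib prod_dividef)
  also have "\<dots> = (-1) ^ r * (exp (\<Sum>s=1..r. e s) *
      (euler_prod z / euler_prod w / (euler_prod w ^ 2) ^ r))"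
    unfolding w_def prod_qpoch_progression[OF assms] by (simp add: exp_sum)
  finally have "(\<Prod>s=1..r. klein (of_nat s / of_nat p) 0 w) = (-1) ^ r * (exp (\<Sum>s=1..r. e s) *
      (euler_prod z / euler_prod w / (euler_prod w ^ 2) ^ r))" .
  moreover have "exp (\<Sum>s=1..r. e s) = qexp (- (real p ^ 2 - 1) / 24) z"
  proof -
    have p0: "complex_of_nat p \<noteq> 0"
      by (subst of_nat_eq_0_iff) (simp add: p)
    have "6 * (\<Sum>s=1..r. of_nat (s ^ 2)) = of_nat r * (of_nat r + 1) * (of_nat p :: complex)"
      using arg_cong[OF sum_squares_upto[of r], of "of_nat :: nat \<Rightarrow> complex"]
      by (simp add: p algebra_simps)
    hence 1: "(\<Sum>s=1..r. of_nat (s ^ 2)) / of_nat p = of_nat r * (of_nat r + 1) / (6 :: complex)"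
      using p0 by (simp add: field_simps)
    have 2: "(\<Sum>s=1..r. of_nat s) = of_nat r * (of_nat r + 1) / (2 :: complex)"
      using arg_cong[OF sum_upto[of r], of "of_nat :: nat \<Rightarrow> complex"] by (simp add: field_simps)
    have "(\<Sum>s=1..r. e s) = \<i> * of_real pi * z *
        ((\<Sum>s=1..r. of_nat (s ^ 2)) / of_nat p - (\<Sum>s=1..r. of_nat s))"
      unfolding e_def by (simp only: sum_distrib_left[symmetric] sum_divide_distrib sum_subtractf)
    also have "\<dots> = 2 * pi * \<i> * of_real (- (real p ^ 2 - 1) / 24) * z"
      unfolding 1 2 unfolding p by (simp add: field_simps power2_eq_square)
    finally show ?thesis by (simp only: qexp_def)
  qed
  moreover have "euler_prod w ^ p = euler_prod w * (euler_prod w ^ 2) ^ r"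
    by (simp add: p power_mult)
  ultimately show ?thesis
    by (simp add: w_def)
qed

text \<open>In the quotient of the two products the p-th powers of the Euler product at p z cancel.
  The Euler product at z that is left in the denominator cancels against the one in the last Klein
  form, which is a constant divided by that Euler product and the crank function.\<close>

lemma crank_form_conv_klein:
  fixes p l r :: nat
  assumes p: "p = 2 * r + 1" and l: "1 \<le> l" "l < p"
  obtains C where "\<And>z. Im z > 0 \<Longrightarrow>
    dedekind_eta (of_nat (p ^ 2) * z) * qexp (-1/24) z
           * crank_gf (exp (2 * pi * \<i> / of_nat p) ^ l) (qexp 1 z) =
    C * ((\<Prod>s=1..r. klein 0 (of_nat s / of_nat p) (of_nat p * z)) /
         (\<Prod>s=1..r. klein (of_nat s / of_nat p) 0 (of_nat p * z))) / klein 0 (of_nat l / of_nat p) z"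
proof
  fix z :: complex assume z: "Im z > 0"
  define S where "S = (\<lambda>s. 2 * \<i> * sin (of_real pi * (of_nat s / complex_of_nat p)))"
  have S: "S s \<noteq> 0" if "s \<in> {1..<p}" for s
  proof
    assume "S s = 0"
    hence "qexp 1 (of_nat s / of_nat p) = 1"
      using sin_conv_qexp[of "of_nat s / of_nat p"] by (simp add: S_def qexp_nonzero)
    then obtain m :: int where "of_nat s / of_nat p = complex_of_int m"
      by (auto simp: qexp_eq_1_iff)
    hence "complex_of_int (int s) = complex_of_int (m * int p)"
      using p by (simp add: field_simps del: of_nat_Suc of_nat_add)
    hence "int s = m * int p"
      by (simp only: of_int_eq_iff)
    hence "int p dvd int s"
      by simp
    thus False using that by (auto simp: nat_dvd_not_less)
  qed
  have nz: "euler_prod z \<noteq> 0" "euler_prod (of_nat p * z) \<noteq> 0"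
    using z p by (auto intro!: euler_prod_nonzero)
  have root: "exp (2 * pi * \<i> / of_nat p) ^ l = qexp 1 (of_nat l / of_nat p)"
    by (simp add: qexp_def exp_of_nat_mult[symmetric] mult_ac)
  have k: "klein 0 (of_nat l / of_nat p) z = S l / (euler_prod z * crank_gf (qexp 1 (of_nat l / of_nat p)) (qexp 1 z))"
    using nz by (simp add: klein_def norm_theta_def S_def crank_gf_def euler_prod_def qexp_minus power2_eq_square)
  have eta: "dedekind_eta (of_nat (p ^ 2) * z) * qexp (-1/24) z =
      inverse (qexp (- (real p ^ 2 - 1) / 24) z) * euler_prod (of_nat (p ^ 2) * z)"
  proof -
    have "qexp (1/24) (of_nat (p ^ 2) * z) * qexp (-1/24) z = inverse (qexp (- (real p ^ 2 - 1) / 24) z)"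
      unfolding qexp_def exp_minus[symmetric] exp_add[symmetric]
      by (rule arg_cong[of _ _ exp]) (simp add: field_simps)
    thus ?thesis by (simp add: dedekind_eta_conv_euler_prod mult_ac)
  qed
  have "(\<Prod>s=1..r. S s) \<noteq> 0"
    using S p by auto
  moreover have "S l \<noteq> 0"
    using S l by auto
  \<comment> \<open>The constant removes the sines of the column product and of the l-th Klein form
    as well as the sign of the row product.\<close>
  ultimately show "dedekind_eta (of_nat (p ^ 2) * z) * qexp (-1/24) z
           * crank_gf (exp (2 * pi * \<i> / of_nat p) ^ l) (qexp 1 z) =
    ((-1) ^ r * S l / (\<Prod>s=1..r. S s)) * ((\<Prod>s=1..r. klein 0 (of_nat s / of_nat p) (of_nat p * z)) /
         (\<Prod>s=1..r. klein (of_nat s / of_nat p) 0 (of_nat p * z))) / klein 0 (of_nat l / of_nat p) z"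
    unfolding root prod_klein_column[OF z p] prod_klein_row[OF z p] k eta S_def[symmetric]
    using nz qexp_nonzero by (simp add: field_simps)
qed

section \<open>Invariance of the crank form under the group\<close>

text \<open>Since 3 divides r (r + 1)(2 r + 1) but not p, the even number r (r + 1) equals 6 m. The
  exponents then add up to pi i t (3 m + \<sigma> m), an even multiple of pi i. The sign \<sigma> is
  -1 for the column forms and 1 for the row forms.\<close>

lemma prod_klein_multiplier:
  fixes t :: int and \<sigma> :: complex
  assumes p: "p = 2 * r + 1" and "\<not> 3 dvd p" and \<sigma>: "\<sigma> = 1 \<or> \<sigma> = -1"
  shows "(\<Prod>s=1..r. exp (\<i> * of_real pi * (of_int (int s * t) + \<sigma> * (of_nat s / of_nat p) * of_int (int s * t)))) = 1"
proof -
  have "3 dvd r * (r + 1) * (2 * r + 1)"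
    unfolding sum_squares_upto[symmetric] by (simp add: dvd_def)
  hence "3 dvd r * (r + 1)"
    using assms(2) prime_dvd_multD[of "3::nat" "r * (r + 1)" p] by (auto simp: p)
  moreover have "2 dvd r * (r + 1)"
    by simp
  ultimately have "2 * 3 dvd r * (r + 1)"
    by (intro divides_mult) auto
  then obtain m where m: "r * (r + 1) = 6 * m"
    by (auto simp: dvd_def)
  have p0: "complex_of_nat p \<noteq> 0"
    by (subst of_nat_eq_0_iff) (simp add: p)
  have S2: "(\<Sum>s=1..r. s ^ 2) = m * p"
    using sum_squares_upto[of r] m by (simp add: p)
  have S1: "(\<Sum>s=1..r. s) = 3 * m"
    using sum_upto[of r] m by simp
  define k :: int where "k = (if \<sigma> = 1 then 4 * m else 2 * m)"
  have "(\<Sum>s=1..r. \<i> * of_real pi * (of_int (int s * t) + \<sigma> * (of_nat s / of_nat p) * of_int (int s * t)))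
      = \<i> * of_real pi * of_int t * (of_nat (\<Sum>s=1..r. s) + \<sigma> * of_nat (\<Sum>s=1..r. s ^ 2) / of_nat p)"
    by (simp add: sum_distrib_left sum_distrib_right sum_divide_distrib sum.distrib algebra_simps power2_eq_square)
  also have "\<dots> = \<i> * of_real pi * of_int (t * k)"
    unfolding S1 S2 using \<sigma> p0 by (auto simp: k_def)
  also have "exp \<dots> = 1"
    by (rule exp_pi_i_even) (simp add: k_def)
  finally show ?thesis
    by (simp only: exp_sum finite_atLeastAtMost)
qed

lemma exp_pi_i_add_even:
  assumes "even n"
  shows "exp (\<i> * of_real pi * (of_int n + x)) = exp (\<i> * of_real pi * x)"
  using exp_pi_i_even[OF assms] by (simp add: distrib_left exp_add)

text \<open>The map \<open>z \<mapsto> p z\<close> conjugates \<open>(a, b; c, d)\<close> to \<open>(a, p b; c/p, d)\<close>, which is congruent to the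
  identity modulo \<open>p\<close>; hence every Klein form is only multiplied by a root of unity.\<close>

lemma crank_form_invariant:
  fixes p l r :: nat and a b c d :: int
  defines "f \<equiv> \<lambda>z. dedekind_eta (of_nat (p ^ 2) * z) * qexp (-1/24) z
           * crank_gf (exp (2 * pi * \<i> / of_nat p) ^ l) (qexp 1 z)"
  assumes p: "p = 2 * r + 1" "\<not> 3 dvd p" and l: "1 \<le> l" "l < p"
    and g: "(a, b, c, d) \<in> Gamma0_Gamma1 (int p ^ 2) (int p)" and z: "Im z > 0"
  shows "f ((of_int a * z + of_int b) / (of_int c * z + of_int d)) = (of_int c * z + of_int d) * f z"
proof -
  have det: "a * d - b * c = 1" and "int p ^ 2 dvd c" and "a mod int p = 1 mod int p" "d mod int p = 1 mod int p"
    using g by (auto simp: Gamma0_Gamma1_def SL2Z_def)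
  then obtain c' a0 d0 where c': "c = int p ^ 2 * c'" and "a - 1 = int p * a0" and "d - 1 = int p * d0"
    by (auto simp: mod_eq_dvd_iff elim!: dvdE)
  hence a0: "a = 1 + int p * a0" and d0: "d = 1 + int p * d0"
    by auto
  have oddp: "odd (int p)"
    using p by simp
  have parity: "odd (a * d - b * c)"
    using det by simp
  \<comment> \<open>If d0 is odd then d is even because p is odd, so the determinant forces c' to be
    odd. Then s and 1 + s c' have opposite parity. The argument for a0 and b is the same.\<close>
  have ev_d: "even (int s * d0 * (1 + int s * c'))" for s
    using parity oddp unfolding c' d0 by auto
  have ev_a: "even (int s * a0 * (1 + int s * b))" for s
    using parity oddp unfolding c' a0 by auto
  have p0: "complex_of_nat p \<noteq> 0"
    by (subst of_nat_eq_0_iff) (simp add: p)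
  define j where "j = of_int c * z + of_int d"
  define gz where "gz = (of_int a * z + of_int b) / j"
  have j: "j \<noteq> 0" and gz: "Im gz > 0"
    using Im_moebius[OF det z] by (auto simp: j_def gz_def)
  define w where "w = of_nat p * z"
  have w: "Im w > 0"
    using z p by (simp add: w_def)
  have det': "a * d - (int p * b) * (int p * c') = 1"
    using det by (simp add: c' power2_eq_square algebra_simps)
  have j': "of_int (int p * c') * w + of_int d = j"
    by (simp add: j_def w_def c' power2_eq_square algebra_simps)
  have pgz: "of_nat p * gz = (of_int a * w + of_int (int p * b)) / (of_int (int p * c') * w + of_int d)"
    unfolding j' by (simp add: gz_def w_def algebra_simps)
  \<comment> \<open>The transformed characteristic is (s c', s/p + s d0). Of the exponent in
    \<open>klein_shift\<close>, the part s d0 (1 + s c') is even and drops out, which leaves the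
    shape of \<open>prod_klein_multiplier\<close>.\<close>
  have col: "klein 0 (of_nat s / of_nat p) (of_nat p * gz) =
      exp (\<i> * of_real pi * (of_int (int s * c') + (-1) * (of_nat s / of_nat p) * of_int (int s * c'))) *
      (klein 0 (of_nat s / of_nat p) w / j)" for s
  proof -
    have "klein 0 (of_nat s / of_nat p) (of_nat p * gz) =
        klein (0 + of_int (int s * c')) (of_nat s / of_nat p + of_int (int s * d0)) w / j"
      unfolding pgz unfolding klein_moebius[OF det' w] unfolding j' using p0 by (simp add: d0 field_simps)
    also have "\<dots> = exp (\<i> * of_real pi * (of_int (int s * d0 * (1 + int s * c')) +
        (of_int (int s * c') + (-1) * (of_nat s / of_nat p) * of_int (int s * c')))) *
        (klein 0 (of_nat s / of_nat p) w / j)"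
      unfolding klein_shift[OF w] by (simp add: algebra_simps)
    finally show ?thesis
      unfolding exp_pi_i_add_even[OF ev_d] .
  qed
  have row: "klein (of_nat s / of_nat p) 0 (of_nat p * gz) =
      exp (\<i> * of_real pi * (of_int (int s * b) + 1 * (of_nat s / of_nat p) * of_int (int s * b))) *
      (klein (of_nat s / of_nat p) 0 w / j)" for s
  proof -
    have "klein (of_nat s / of_nat p) 0 (of_nat p * gz) =
        klein (of_nat s / of_nat p + of_int (int s * a0)) (0 + of_int (int s * b)) w / j"
      unfolding pgz unfolding klein_moebius[OF det' w] unfolding j' using p0 by (simp add: a0 field_simps)
    also have "\<dots> = exp (\<i> * of_real pi * (of_int (int s * a0 * (1 + int s * b)) +
        (of_int (int s * b) + 1 * (of_nat s / of_nat p) * of_int (int s * b)))) *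
        (klein (of_nat s / of_nat p) 0 w / j)"
      unfolding klein_shift[OF w] by (simp add: algebra_simps)
    finally show ?thesis
      unfolding exp_pi_i_add_even[OF ev_a] .
  qed
  \<comment> \<open>Both products acquire the same factor j^(-r), which cancels in their quotient.
    The weight comes from the single Klein form at z alone.\<close>
  have prod_col: "(\<Prod>s=1..r. klein 0 (of_nat s / of_nat p) (of_nat p * gz)) =
      (\<Prod>s=1..r. klein 0 (of_nat s / of_nat p) w) / j ^ r"
    unfolding col prod.distrib using prod_klein_multiplier[OF p, of "-1" c'] by (simp add: prod_dividef)
  have prod_row: "(\<Prod>s=1..r. klein (of_nat s / of_nat p) 0 (of_nat p * gz)) =
      (\<Prod>s=1..r. klein (of_nat s / of_nat p) 0 w) / j ^ r"
    unfolding row prod.distrib using prod_klein_multiplier[OF p, of 1 b] by (simp add: prod_dividef)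
  have kl: "klein 0 (of_nat l / of_nat p) gz = klein 0 (of_nat l / of_nat p) z / j"
  proof -
    \<comment> \<open>Here \<beta> m = (l/p)(l p c') is an integer, so the whole exponent is
      integral. Modulo 2 it is l d0 (1 + c'), even by the parity of the determinant.\<close>
    have ev: "even (int l * int p * c' + int l * d0 + int l * int p * c' * (int l * d0) - int l ^ 2 * c')"
      using parity oddp unfolding c' d0 by auto
    have "klein 0 (of_nat l / of_nat p) gz =
        klein (0 + of_int (int l * int p * c')) (of_nat l / of_nat p + of_int (int l * d0)) z / j"
      unfolding gz_def j_def klein_moebius[OF det z] using p0 by (simp add: d0 c' field_simps power2_eq_square)
    also have "\<dots> = exp (\<i> * of_real pi * of_int (int l * int p * c' + int l * d0
        + int l * int p * c' * (int l * d0) - int l ^ 2 * c')) * (klein 0 (of_nat l / of_nat p) z / j)"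
      unfolding klein_shift[OF z] using p0 by (simp add: algebra_simps power2_eq_square)
    finally show ?thesis
      unfolding exp_pi_i_even[OF ev] by simp
  qed
  obtain C where C: "\<And>z. Im z > 0 \<Longrightarrow> f z =
    C * ((\<Prod>s=1..r. klein 0 (of_nat s / of_nat p) (of_nat p * z)) /
         (\<Prod>s=1..r. klein (of_nat s / of_nat p) 0 (of_nat p * z))) / klein 0 (of_nat l / of_nat p) z"
    using crank_form_conv_klein[OF p(1) l] unfolding f_def by metis
  have "f gz = j * f z"
    unfolding C[OF gz] C[OF z] prod_col prod_row kl w_def[symmetric] using j by simp
  thus ?thesis
    by (simp add: gz_def j_def)
qed

section \<open>Behaviour at the cusps\<close>

text \<open>By periodicity F descends to a function g on the punctured unit disc, and the
  exponential bound turns into |g(w)| \<le> |w|^(-M) near 0. Riemann's theorem then extends w^M g(w)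
  over 0, leaving at worst a pole of g.\<close>

lemma not_essential_periodic:
  fixes F :: "complex \<Rightarrow> complex" and N :: nat
  assumes N: "N > 0" and hol: "F holomorphic_on {z. Im z > 0}"
    and per: "\<And>z. Im z > 0 \<Longrightarrow> F (z + of_nat N) = F z"
    and bound: "\<And>z. Im z \<ge> 1 \<Longrightarrow> \<bar>Re z\<bar> \<le> N \<Longrightarrow> norm (F z) \<le> exp (K * Im z)"
  shows "not_essential (\<lambda>w. F (of_nat N * Ln w / (2 * pi * \<i>))) 0"
proof -
  define e where "e = (\<lambda>L. of_nat N * L / (2 * of_real pi * \<i>))"
  define g where "g = (\<lambda>w. F (e (Ln w)))"
  have Im_e: "Im (e L) = - real N * Re L / (2 * pi)" and Re_e: "Re (e L) = real N * Im L / (2 * pi)" for L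
    by (simp_all add: e_def Im_divide Re_divide power2_eq_square field_simps)
  have per': "F (z + of_int n * of_nat N) = F z" if "Im z > 0" for z n
  proof (induction n rule: int_induct[of _ 0])
    case (step1 i)
    thus ?case using per[of "z + of_int i * of_nat N"] that by (simp add: algebra_simps)
  next
    case (step2 i)
    thus ?case using per[of "z + of_int i * of_nat N - of_nat N"] that by (simp add: algebra_simps)
  qed auto
  have "g analytic_on {w0}" if w0: "w0 \<in> ball 0 1 - {0}" for w0
  proof -
    \<comment> \<open>For w in \<open>S\<close> the quotient w / w0 lies in the disc of radius 1
      about 1. Hence \<open>L\<close> is a holomorphic branch of the logarithm even if w0 is on the
      cut of \<open>Ln\<close>.\<close>
    define S where "S = ball w0 (norm w0) \<inter> ball 0 1"
    define L where "L = (\<lambda>w. Ln (w / w0) + Ln w0)"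
    have S: "open S" "w0 \<in> S" "0 \<notin> S"
      using w0 by (auto simp: S_def)
    have nonpos: "w / w0 \<notin> \<real>\<^sub>\<le>\<^sub>0" if "w \<in> S" for w
    proof -
      have "norm (1 - w / w0) = norm (w0 - w) / norm w0"
        using w0 by (simp add: norm_divide[symmetric] diff_divide_distrib)
      also have "\<dots> < 1"
        using that w0 by (simp add: S_def dist_norm)
      finally have "Re (1 - w / w0) < 1"
        using complex_Re_le_cmod[of "1 - w / w0"] by linarith
      thus ?thesis
        by (auto simp: complex_nonpos_Reals_iff)
    qed
    have expL: "exp (L w) = w" if "w \<in> S" for w
    proof -
      have "w \<noteq> 0" "w0 \<noteq> 0"
        using that S(3) w0 by auto
      thus ?thesis by (simp add: L_def exp_add)
    qed
    have posL: "Im (e (L w)) > 0" if "w \<in> S" for w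
    proof -
      have w: "norm w < 1" "w \<noteq> 0"
        using that S by (auto simp: S_def)
      have "exp (Re (L w)) = norm w"
        using expL[OF that] by (metis norm_exp_eq_Re)
      hence "Re (L w) < 0"
        using w by (metis exp_less_one_iff)
      thus ?thesis
        using N by (simp add: Im_e mult_pos_neg divide_neg_pos)
    qed
    have "L holomorphic_on S"
      unfolding L_def using nonpos w0 by (auto intro!: holomorphic_intros)
    hence "(\<lambda>w. e (L w)) holomorphic_on S"
      unfolding e_def by (intro holomorphic_intros) auto
    hence "(F \<circ> (\<lambda>w. e (L w))) holomorphic_on S"
      by (rule holomorphic_on_compose_gen[OF _ hol]) (use posL in auto)
    \<comment> \<open>\<open>Ln\<close> w and \<open>L\<close> w differ by 2 pi i n, so their images
      under \<open>e\<close> differ by n N, a period of F.\<close>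
    moreover have "(F \<circ> (\<lambda>w. e (L w))) w = g w" if "w \<in> S" for w
    proof -
      have "exp (Ln w) = exp (L w)"
        using expL[OF that] S that by (metis exp_Ln)
      then obtain n :: int where "Ln w = L w + of_int (2 * n) * pi * \<i>"
        by (auto simp: exp_eq)
      hence "e (Ln w) = e (L w) + of_int n * of_nat N"
        by (simp add: e_def field_simps)
      thus ?thesis
        using per'[OF posL[OF that], of n] by (simp add: g_def)
    qed
    ultimately have "g holomorphic_on S"
      by (rule holomorphic_transform)
    thus ?thesis
      using S by (auto simp: analytic_at)
  qed
  hence hol_g: "g holomorphic_on ball 0 1 - {0}"
    using analytic_on_analytic_at analytic_imp_holomorphic by blast
  \<comment> \<open>At z = \<open>e\<close> (\<open>Ln\<close> w) one has Im z = -N ln |w| / (2 pi),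
    so exp(|K| Im z) is |w| to the power -|K| N / (2 pi).\<close>
  define M where "M = nat \<lceil>\<bar>K\<bar> * real N / (2 * pi)\<rceil>"
  have M: "\<bar>K\<bar> * real N / (2 * pi) \<le> real M"
    unfolding M_def by linarith
  have "eventually (\<lambda>w. norm (w ^ M * g w) \<le> 1) (at 0)"
  proof -
    \<comment> \<open>This radius guarantees Im z > 1. The principal branch of the logarithm keeps
      |Re z| \<le> N / 2, inside the strip of the bound.\<close>
    have "eventually (\<lambda>w::complex. w \<in> ball 0 (exp (- (2 * pi) / N)) - {0}) (at 0)"
      by (intro eventually_at_in_open) auto
    thus ?thesis
    proof eventually_elim
      case (elim w)
      hence w: "w \<noteq> 0" "norm w < exp (- (2 * pi) / N)"
        by auto
      have "ln (norm w) < - (2 * pi) / N"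
        using w by (metis exp_less_cancel_iff exp_ln zero_less_norm_iff)
      hence lnw: "- real N * ln (norm w) / (2 * pi) \<ge> 1"
        using N by (simp add: field_simps)
      have "\<bar>real N * Im (Ln w) / (2 * pi)\<bar> = real N * \<bar>Im (Ln w)\<bar> / (2 * pi)"
        by (simp add: abs_mult)
      also have "\<dots> \<le> real N * pi / (2 * pi)"
        using mpi_less_Im_Ln[OF w(1)] Im_Ln_le_pi[OF w(1)]
        by (intro divide_right_mono mult_left_mono) auto
      also have "\<dots> \<le> real N"
        by simp
      finally have "norm (g w) \<le> exp (K * (- real N * ln (norm w) / (2 * pi)))"
        unfolding g_def using bound[of "e (Ln w)"] lnw w by (simp add: Im_e Re_e)
      also have "K * (- real N * ln (norm w) / (2 * pi)) \<le> \<bar>K\<bar> * (- real N * ln (norm w) / (2 * pi))"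
        using lnw by (intro mult_right_mono) auto
      also have "\<dots> = (\<bar>K\<bar> * real N / (2 * pi)) * (- ln (norm w))"
        by simp
      also have "\<dots> \<le> real M * (- ln (norm w))"
      proof (rule mult_right_mono[OF M])
        have "- (2 * pi) / N \<le> 0"
          by simp
        thus "0 \<le> - ln (norm w)"
          using \<open>ln (norm w) < - (2 * pi) / N\<close> by linarith
      qed
      finally have "norm (g w) \<le> exp (real M * (- ln (norm w)))"
        by simp
      also have "\<dots> = inverse (norm w ^ M)"
        using w by (simp add: exp_minus exp_of_nat_mult)
      finally have "norm w ^ M * norm (g w) \<le> norm w ^ M * inverse (norm w ^ M)"
        by (intro mult_left_mono) auto
      thus ?case
        using w by (simp add: norm_mult norm_power)
    qed
  qed
  moreover have "(\<lambda>w. w ^ M * g w) holomorphic_on ball 0 1 - {0}"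
    by (intro holomorphic_intros hol_g)
  ultimately obtain h where h: "h holomorphic_on ball 0 1" "\<And>w. w \<in> ball 0 1 - {0} \<Longrightarrow> h w = w ^ M * g w"
    using holomorphic_on_extend_bounded[of "\<lambda>w. w ^ M * g w" "ball 0 1" 0] by auto
  have "h analytic_on {0}"
    unfolding analytic_at using h(1) by (intro exI[of _ "ball 0 1"]) auto
  hence "not_essential (\<lambda>w. h w / w ^ M) 0"
    by (intro not_essential_divide not_essential_analytic isolated_singularity_at_analytic analytic_intros)
  moreover have "eventually (\<lambda>w. h w / w ^ M = g w) (at 0)"
  proof -
    have "eventually (\<lambda>w::complex. w \<in> ball 0 1 - {0}) (at 0)"
      by (intro eventually_at_in_open) auto
    thus ?thesis
      by eventually_elim (use h(2) in auto)
  qed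
  ultimately have "not_essential g 0"
    using not_essential_cong[of "\<lambda>w. h w / w ^ M" g 0 0] by simp
  thus ?thesis
    by (simp add: g_def[abs_def] e_def)
qed

section \<open>Holomorphy and growth of the crank form\<close>

lemma holomorphic_on_qexp [holomorphic_intros]:
  "A holomorphic_on S \<Longrightarrow> (\<lambda>z. qexp r (A z)) holomorphic_on S"
  unfolding qexp_def by (intro holomorphic_intros)

lemma holomorphic_dedekind_eta:
  assumes "n > 0"
  shows "(\<lambda>z. dedekind_eta (of_nat n * z)) holomorphic_on upper_half_plane"
  unfolding dedekind_eta_conv_euler_prod euler_prod_def
  by (intro holomorphic_intros holomorphic_on_qpoch)
     (use assms in \<open>auto simp: upper_half_plane_def open_halfspace_Im_gt intro!: norm_qexp_less_one\<close>)

lemma qpoch_unit_nonzero: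
  assumes "norm q < 1" "norm x = 1"
  shows "qpoch_inf (x * q) q \<noteq> 0"
  using assms by (intro qpoch_nonzero) (auto simp: norm_mult)

lemma holomorphic_crank_gf:
  assumes "norm x = 1"
  shows "(\<lambda>z. crank_gf x (qexp 1 z)) holomorphic_on upper_half_plane"
proof -
  have "norm (inverse x) = 1"
    using assms by (simp add: norm_inverse)
  with assms show ?thesis
    unfolding crank_gf_def
    by (intro holomorphic_intros holomorphic_on_qpoch)
       (auto simp: upper_half_plane_def open_halfspace_Im_gt norm_qexp_less_one qpoch_unit_nonzero)
qed

text \<open>Two Euler products in the numerator and two inverse products from the crank denominator
  give exp((2 + 2 D) / (1 - |q|)), with D = zeta(2). The inequality exp(-t) \<le> 1 / (1 + t) at t =
  2 pi Im z bounds 1 / (1 - |q|) by 1 + 1 / Im z. The remaining power of q has modulus at most 1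
  because n \<ge> 1.\<close>

lemma crank_form_bound:
  assumes x: "norm x = 1" and n: "n > 0"
  obtains K where "K > 0" "\<And>z. Im z > 0 \<Longrightarrow>
    norm (dedekind_eta (of_nat n * z) * qexp (-1/24) z * crank_gf x (qexp 1 z)) \<le> exp (K * (1 + 1 / Im z))"
proof
  define D where "D = (\<Sum>n. 1 / real n ^ 2)"
  have "D \<ge> 0"
    unfolding D_def by (intro suminf_nonneg) (use inverse_power_summable[of 2, where 'a = real] in \<open>auto simp: field_simps\<close>)
  thus "2 + 2 * D > 0"
    by simp
  fix z :: complex assume z: "Im z > 0"
  define q where "q = qexp 1 z"
  define Y where "Y = 1 / (1 - norm q)"
  have q: "norm q < 1"
    unfolding q_def by (rule norm_qexp_less_one[OF z])
  have qn: "qexp 1 (of_nat n * z) = q ^ n"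
    by (simp add: q_def qexp_power)
  have "norm q ^ n \<le> norm q ^ 1"
    using q n by (intro power_decreasing) auto
  hence qn_le: "norm (q ^ n) \<le> norm q"
    by (simp add: norm_power)
  have inv: "norm (inverse x) = 1"
    using x by (simp add: norm_inverse)
  have Y: "Y \<le> 1 + 1 / Im z"
  proof -
    define t where "t = 2 * pi * Im z"
    have t: "t > 0" "t \<ge> Im z"
      using z pi_ge_two mult_right_mono[of 1 "2 * pi" "Im z"] by (auto simp: t_def)
    have nq: "norm q = inverse (exp t)"
      by (simp add: q_def qexp_def t_def exp_minus[symmetric])
    have "norm q \<le> inverse (1 + t)"
      unfolding nq using t exp_ge_add_one_self[of t] by (intro le_imp_inverse_le) auto
    hence "1 - norm q \<ge> t / (1 + t)"
      using t by (simp add: field_simps)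
    hence "Y \<le> 1 / (t / (1 + t))"
      unfolding Y_def using t q by (intro divide_left_mono mult_pos_pos divide_pos_pos) auto
    also have "\<dots> = 1 + 1 / t"
      using t by (simp add: field_simps)
    also have "1 / t \<le> 1 / Im z"
      using t z by (intro divide_left_mono) auto
    finally show ?thesis by simp
  qed
  have 1: "norm (qexp (1/24) (of_nat n * z) * qexp (-1/24) z) \<le> 1"
  proof -
    have "norm (qexp (1/24) (of_nat n * z) * qexp (-1/24) z) = exp (- (2 * pi * Im z * (real n - 1) / 24))"
      by (simp add: qexp_def norm_mult exp_add[symmetric] field_simps)
    thus ?thesis using z n by simp
  qed
  have 2: "norm (qpoch_inf (q ^ n) (q ^ n)) \<le> exp Y"
  proof -
    have "norm (qpoch_inf (1 * q ^ n) (q ^ n)) \<le> exp (1 / (1 - norm (q ^ n)))"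
      by (rule norm_qpoch_le) (use qn_le q in auto)
    also have "1 / (1 - norm (q ^ n)) \<le> Y"
      unfolding Y_def using qn_le q by (intro divide_left_mono mult_pos_pos) auto
    finally show ?thesis by simp
  qed
  have 3: "norm (qpoch_inf q q) \<le> exp Y"
    using norm_qpoch_le[OF q, of 1] by (simp add: Y_def)
  have 4: "norm (inverse (qpoch_inf (y * q) q)) \<le> exp (D * Y)" if "norm y = 1" for y
  proof -
    have "exp (- (D * Y)) \<le> norm (qpoch_inf (y * q) q)"
      using norm_qpoch_ge[OF q, of y] that by (simp add: Y_def D_def)
    hence "inverse (norm (qpoch_inf (y * q) q)) \<le> inverse (exp (- (D * Y)))"
      by (intro le_imp_inverse_le) auto
    thus ?thesis by (simp add: norm_inverse exp_minus)
  qed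
  have "norm (dedekind_eta (of_nat n * z) * qexp (-1/24) z * crank_gf x q) =
      norm (qexp (1/24) (of_nat n * z) * qexp (-1/24) z) * (norm (qpoch_inf (q ^ n) (q ^ n)) *
      (norm (qpoch_inf q q) * (norm (inverse (qpoch_inf (x * q) q)) * norm (inverse (qpoch_inf (inverse x * q) q)))))"
    unfolding dedekind_eta_conv_euler_prod euler_prod_def qn crank_gf_def
    by (simp only: norm_mult norm_divide norm_inverse divide_inverse inverse_mult_distrib mult_ac)
  also have "\<dots> \<le> 1 * (exp Y * (exp Y * (exp (D * Y) * exp (D * Y))))"
    by (intro mult_mono 1 2 3 4 x inv mult_nonneg_nonneg norm_ge_zero) auto
  also have "\<dots> = exp ((2 + 2 * D) * Y)"
    by (simp add: exp_add[symmetric] algebra_simps)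
  also have "\<dots> \<le> exp ((2 + 2 * D) * (1 + 1 / Im z))"
    using Y \<open>D \<ge> 0\<close> by (simp add: mult_left_mono)
  finally show "norm (dedekind_eta (of_nat n * z) * qexp (-1/24) z * crank_gf x (qexp 1 z))
      \<le> exp ((2 + 2 * D) * (1 + 1 / Im z))"
    by (simp add: q_def)
qed

text \<open>In the strip, 1 / Im (g z) = |c z + d|^2 / Im z grows at most linearly in Im z. The
  automorphy factor does no harm since |c z + d| \<ge> 1: either c = 0 and d is a unit, or |c| Im z
  \<ge> 1.\<close>

lemma slash_bound:
  fixes a b c d :: int
  assumes det: "a * d - b * c = 1" and "K > 0"
    and f: "\<And>z. Im z > 0 \<Longrightarrow> norm (f z) \<le> exp (K * (1 + 1 / Im z))"
  obtains A where "\<And>z. Im z \<ge> 1 \<Longrightarrow> \<bar>Re z\<bar> \<le> N \<Longrightarrow> norm (slash 1 f (a, b, c, d) z) \<le> exp (A * Im z)"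
proof
  \<comment> \<open>Chosen so that |c z + d|^2 \<le> B (Im z)^2 throughout the strip: the first
    summand bounds the real part, the second the imaginary part.\<close>
  define B where "B = (\<bar>real_of_int c\<bar> * N + \<bar>real_of_int d\<bar>) ^ 2 + real_of_int c ^ 2"
  fix z assume z: "Im z \<ge> 1" "\<bar>Re z\<bar> \<le> N"
  define j where "j = of_int c * z + of_int d"
  define w where "w = (of_int a * z + of_int b) / j"
  have w: "Im w = Im z / norm j ^ 2" "Im w > 0" and j: "j \<noteq> 0"
    using Im_moebius[OF det, of z] z by (auto simp: w_def j_def)
  have "norm j \<ge> 1"
  proof (cases "c = 0")
    case True
    hence "\<bar>d\<bar> = 1"
      using det by (metis abs_mult_self_eq diff_0_right dvd_triv_right mult_zero_right zdvd1_eq)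
    hence "\<bar>real_of_int d\<bar> = 1"
      by linarith
    thus ?thesis using True by (simp add: j_def)
  next
    case False
    hence "1 \<le> \<bar>real_of_int c\<bar>"
      by linarith
    hence "1 * 1 \<le> \<bar>real_of_int c\<bar> * Im z"
      using z by (intro mult_mono) auto
    also have "\<dots> = \<bar>Im j\<bar>"
      using z by (simp add: j_def abs_mult)
    also have "\<dots> \<le> norm j"
      by (rule abs_Im_le_cmod)
    finally show ?thesis by simp
  qed
  have "norm j ^ 2 = (real_of_int c * Re z + real_of_int d) ^ 2 + (real_of_int c * Im z) ^ 2"
    by (simp add: cmod_power2 j_def)
  also have "(real_of_int c * Re z + real_of_int d) ^ 2 \<le> (\<bar>real_of_int c\<bar> * N + \<bar>real_of_int d\<bar>) ^ 2 * Im z ^ 2"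
  proof -
    have "\<bar>real_of_int c * Re z + real_of_int d\<bar> \<le> \<bar>real_of_int c\<bar> * \<bar>Re z\<bar> + \<bar>real_of_int d\<bar>"
      using abs_triangle_ineq[of "real_of_int c * Re z" "real_of_int d"] by (simp add: abs_mult)
    also have "\<dots> \<le> \<bar>real_of_int c\<bar> * N + \<bar>real_of_int d\<bar>"
      using z by (intro add_right_mono mult_left_mono) auto
    finally have "(real_of_int c * Re z + real_of_int d) ^ 2 \<le> (\<bar>real_of_int c\<bar> * N + \<bar>real_of_int d\<bar>) ^ 2"
      by (metis abs_ge_zero power2_abs power_mono)
    also have "\<dots> \<le> (\<bar>real_of_int c\<bar> * N + \<bar>real_of_int d\<bar>) ^ 2 * Im z ^ 2"
      using z mult_left_mono[of 1 "Im z ^ 2" "(\<bar>real_of_int c\<bar> * N + \<bar>real_of_int d\<bar>) ^ 2"] by simp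
    finally show ?thesis .
  qed
  finally have "norm j ^ 2 \<le> B * Im z ^ 2"
    by (simp add: B_def algebra_simps power_mult_distrib)
  hence "1 / Im w \<le> B * Im z ^ 2 / Im z"
    unfolding w(1) using z by (simp add: divide_right_mono)
  hence "1 / Im w \<le> B * Im z"
    using z by (simp add: power2_eq_square)
  hence "K * (1 + 1 / Im w) \<le> K * (Im z + B * Im z)"
    using \<open>K > 0\<close> z by (intro mult_left_mono add_mono) auto
  hence *: "norm (f w) \<le> exp (K * (1 + B) * Im z)"
    using f[OF w(2)] by (simp add: algebra_simps) (metis (no_types, opaque_lifting) exp_le_cancel_iff order_trans)
  have "norm (slash 1 f (a, b, c, d) z) = norm (f w) / norm j"
    by (simp add: slash_def moebius_def power_int_minus norm_mult norm_inverse divide_inverse w_def j_def mult.commute)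
  also have "\<dots> \<le> norm (f w)"
    using mult_left_mono[OF \<open>norm j \<ge> 1\<close>, of "norm (f w)"] j by (simp add: divide_le_eq)
  also note *
  finally show "norm (slash 1 f (a, b, c, d) z) \<le> exp (K * (1 + B) * Im z)" .
qed

lemma holomorphic_slash:
  fixes a b c d :: int
  assumes det: "a * d - b * c = 1" and f: "f holomorphic_on upper_half_plane"
  shows "slash k f (a, b, c, d) holomorphic_on upper_half_plane"
proof -
  have j: "of_int c * z + of_int d \<noteq> 0" if "z \<in> upper_half_plane" for z
    using Im_moebius[OF det, of z] that by (auto simp: upper_half_plane_def)
  have "f \<circ> (\<lambda>z. (of_int a * z + of_int b) / (of_int c * z + of_int d)) holomorphic_on upper_half_plane"
    by (rule holomorphic_on_compose_gen[OF _ f])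
       (use j Im_moebius[OF det] in \<open>auto simp: upper_half_plane_def intro!: holomorphic_intros\<close>)
  moreover have "(\<lambda>z. (of_int c * z + of_int d) powi (- k)) holomorphic_on upper_half_plane"
    by (intro holomorphic_intros) (use j in auto)
  ultimately show ?thesis
    unfolding slash_def moebius_def o_def by (auto intro!: holomorphic_intros)
qed

text \<open>The period is \<open>N\<close> because \<open>g T\<^sup>N g\<^sup>-\<^sup>1\<close> lies in \<open>\<Gamma>(N)\<close>.\<close>

lemma slash_periodic:
  fixes a b c d N :: int
  assumes det: "a * d - b * c = 1" and z: "Im z > 0"
    and inv: "\<And>a b c d z. (a, b, c, d) \<in> SL2Z \<Longrightarrow> N dvd a - 1 \<Longrightarrow> N dvd c \<Longrightarrow> N dvd d - 1 \<Longrightarrow> Im z > 0 \<Longrightarrow>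
      f ((of_int a * z + of_int b) / (of_int c * z + of_int d)) = (of_int c * z + of_int d) * f z"
  shows "slash 1 f (a, b, c, d) (z + of_int N) = slash 1 f (a, b, c, d) z"
proof -
  define j where "j = of_int c * z + of_int d"
  define w where "w = (of_int a * z + of_int b) / j"
  have j: "j \<noteq> 0" and w: "Im w > 0"
    using Im_moebius[OF det z] by (auto simp: j_def w_def)
  have j': "of_int c * (z + of_int N) + of_int d \<noteq> 0"
    using Im_moebius[OF det, of "z + of_int N"] z by auto
  have det': "of_int a * of_int d - of_int b * of_int c = (1 :: complex)"
    using det by (metis of_int_1 of_int_diff of_int_mult)
  have wj: "w * j = of_int a * z + of_int b"
    using j by (simp add: w_def)
  \<comment> \<open>These are the entries of g T^N g^-1, simplified with determinant 1. Applied to w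
    = g z, this matrix yields g (z + N).\<close>
  define A B C D where "A = 1 - N * a * c" and "B = N * a ^ 2" and "C = - (N * c ^ 2)" and "D = 1 + N * a * c"
  have mem: "(A, B, C, D) \<in> SL2Z"
    by (simp add: SL2Z_def A_def B_def C_def D_def algebra_simps power2_eq_square)
  have "(of_int C * w + of_int D) * j = of_int C * (w * j) + of_int D * j"
    by (simp add: algebra_simps)
  also have "\<dots> = of_int c * (z + of_int N) + of_int d"
    using det' unfolding wj unfolding j_def C_def D_def
    by simp algebra
  finally have J: "(of_int C * w + of_int D) * j = of_int c * (z + of_int N) + of_int d" .
  have "(of_int A * w + of_int B) * j = of_int A * (w * j) + of_int B * j"
    by (simp add: algebra_simps)
  also have "\<dots> = of_int a * (z + of_int N) + of_int b"
    using det' unfolding wj unfolding j_def A_def B_def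
    by simp algebra
  finally have I: "(of_int A * w + of_int B) * j = of_int a * (z + of_int N) + of_int b" .
  have "(of_int a * (z + of_int N) + of_int b) / (of_int c * (z + of_int N) + of_int d)
      = (of_int A * w + of_int B) / (of_int C * w + of_int D)"
    unfolding I[symmetric] J[symmetric] using j by simp
  also have "f \<dots> = (of_int C * w + of_int D) * f w"
    by (rule inv[OF mem _ _ _ w]) (simp_all add: A_def C_def D_def)
  finally have F: "f ((of_int a * (z + of_int N) + of_int b) / (of_int c * (z + of_int N) + of_int d))
      = (of_int C * w + of_int D) * f w" .
  have "of_int C * w + of_int D \<noteq> 0"
    using J j' by auto
  hence "inverse (of_int c * (z + of_int N) + of_int d) *
      f ((of_int a * (z + of_int N) + of_int b) / (of_int c * (z + of_int N) + of_int d)) = inverse j * f w"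
    unfolding F unfolding J[symmetric] using j by simp
  thus ?thesis
    by (simp only: slash_def moebius_def prod.case power_int_minus power_int_1_right w_def j_def)
qed

theorem theorem2p4:
  fixes p :: nat and l :: nat
  assumes "prime p" and "p > 3" and "1 \<le> l" and "l \<le> p - 1"
  shows "weakly_holomorphic_modular_form 1 (Gamma0_Gamma1 (int p ^ 2) (int p))
     (\<lambda>z. dedekind_eta (of_nat (p ^ 2) * z) * qexp (-1/24) z
           * crank_gf (exp (2 * pi * \<i> / of_nat p) ^ l) (qexp 1 z))"
proof -
  define f where "f = (\<lambda>z. dedekind_eta (of_nat (p ^ 2) * z) * qexp (-1/24) z
           * crank_gf (exp (2 * pi * \<i> / of_nat p) ^ l) (qexp 1 z))"
  have "odd p"
    using assms prime_odd_nat by auto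
  then obtain r where r: "p = 2 * r + 1"
    by (auto elim: oddE)
  have n3: "\<not> 3 dvd p"
    using assms(1,2) primes_dvd_imp_eq[of 3 p] by auto
  have l: "1 \<le> l" "l < p"
    using assms by auto
  have root: "norm (exp (2 * pi * \<i> / of_nat p) ^ l) = 1"
    by (simp add: norm_power)
  have hol: "f holomorphic_on upper_half_plane"
    unfolding f_def using assms(2)
    by (intro holomorphic_intros holomorphic_dedekind_eta holomorphic_crank_gf root) auto
  have inv: "f ((of_int a * z + of_int b) / (of_int c * z + of_int d)) = (of_int c * z + of_int d) * f z"
    if "(a, b, c, d) \<in> Gamma0_Gamma1 (int p ^ 2) (int p)" "Im z > 0" for a b c d z
    using crank_form_invariant[OF r n3 l that] by (simp only: f_def)
  obtain K where K: "K > 0" "\<And>z. Im z > 0 \<Longrightarrow> norm (f z) \<le> exp (K * (1 + 1 / Im z))"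
    using crank_form_bound[OF root, of "p ^ 2"] assms(2) unfolding f_def by auto
  have "slash 1 f g z = f z" if "g \<in> Gamma0_Gamma1 (int p ^ 2) (int p)" "z \<in> upper_half_plane" for g z
  proof -
    obtain a b c d where g: "g = (a, b, c, d)"
      by (cases g)
    have "a * d - b * c = 1" "Im z > 0"
      using that by (auto simp: g Gamma0_Gamma1_def SL2Z_def upper_half_plane_def)
    thus ?thesis
      using inv[of a b c d z] Im_moebius(1)[of a d b c z] that
      by (simp add: g slash_def moebius_def power_int_minus)
  qed
  moreover have "\<exists>N::nat. N > 0 \<and>
         (\<forall>z\<in>upper_half_plane. slash 1 f g (z + of_nat N) = slash 1 f g z) \<and>
         not_essential (\<lambda>w. slash 1 f g (of_nat N * Ln w / (2 * pi * \<i>))) 0" if "g \<in> SL2Z" for g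
  \<comment> \<open>One period serves all cusps: a matrix in \<open>SL2Z\<close> with diagonal
    entries 1 and lower left entry 0 modulo p^2 belongs to the group.\<close>
  proof (intro exI[of _ "p ^ 2"] conjI ballI)
    obtain a b c d where g: "g = (a, b, c, d)"
      by (cases g)
    have det: "a * d - b * c = 1"
      using that by (simp add: g SL2Z_def)
    have per: "slash 1 f g (z + of_nat (p ^ 2)) = slash 1 f g z" if "Im z > 0" for z
    proof -
      have "slash 1 f (a, b, c, d) (z + of_int (int p ^ 2)) = slash 1 f (a, b, c, d) z"
      proof (rule slash_periodic[OF det that], rule inv)
        fix a b c d :: int
        assume "(a, b, c, d) \<in> SL2Z" and *: "int p ^ 2 dvd a - 1" "int p ^ 2 dvd c" "int p ^ 2 dvd d - 1"
        moreover have "int p dvd int p ^ 2"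
          by (simp add: power2_eq_square)
        with * have "int p dvd a - 1" "int p dvd c" "int p dvd d - 1"
          using dvd_trans by blast+
        ultimately show "(a, b, c, d) \<in> Gamma0_Gamma1 (int p ^ 2) (int p)"
          by (simp add: Gamma0_Gamma1_def mod_eq_dvd_iff)
      qed
      thus ?thesis by (simp add: g)
    qed
    show "slash 1 f g (z + of_nat (p ^ 2)) = slash 1 f g z" if "z \<in> upper_half_plane" for z
      using per that by (simp add: upper_half_plane_def)
    show "p ^ 2 > 0"
      using assms(2) by simp
    obtain A where "\<And>z. Im z \<ge> 1 \<Longrightarrow> \<bar>Re z\<bar> \<le> real (p ^ 2) \<Longrightarrow> norm (slash 1 f g z) \<le> exp (A * Im z)"
      using slash_bound[OF det K] unfolding g by metis
    thus "not_essential (\<lambda>w. slash 1 f g (of_nat (p ^ 2) * Ln w / (2 * pi * \<i>))) 0"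
      using \<open>p ^ 2 > 0\<close> per holomorphic_slash[OF det hol] unfolding upper_half_plane_def g
      by (intro not_essential_periodic) auto
  qed
  ultimately show ?thesis
    using hol unfolding weakly_holomorphic_modular_form_def f_def[symmetric] by blast
qed

end
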